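(* Let $H$ be a graph whose every block has a partite representation. Then $H$ has a zero Turán density in a hypercube, i.e. $\mathrm{ex}(Q_n,H)=o(\|Q_n\|)$ as $n\to\infty$.
   Context: Graphs are finite and simple. $\|G\|$ denotes the number of edges of a graph $G$. A block of a graph is a maximal two-connected subgraph or a bridge. The hypercube $Q_n$ (with ground set $[n]=\{1,\dots,n\}$) is the graph with vertex set $\{A: A\subseteq [n]\}$ whose edges are all pairs $\{A,B\}$ with $A\subseteq B$ and $|A|=|B|-1$. The $i$th vertex layer of $Q_n$ is $V_i=\binom{[n]}{i}$, $0\le i\le n$. The $i$th edge-layer (or simply $i$th layer) $L_i$ of $Q_n$ is the subgraph of $Q_n$ induced by $V_i\cup V_{i-1}$, $1\le i\le n$. For a graph $H$, $\mathrm{ex}(Q_n,H)$ is the largest number of edges in a subgraph $G$ of $Q_n$ such that no subgraph of $G$ is isomorphic to $H$. $H$ has zero Turán density in a hypercube if $\mathrm{ex}(Q_n,H)=o(\|Q_n\|)$. A $k$-uniform hypergraph is $k$-partite if its vertex set can be partitioned into $k$ parts such that each hyperedge has exactly one vertex in each part. A graph $H$ has a $k$-partite representation if for some $n$, $H$ is isomorphic to a subgraph $H'$ (not necessarily induced) of the $k$th layer $L_k$ of $Q_n$ such that $V(H')\cap V_k$ is the edge set of a $k$-partite $k$-uniform hypergraph. $H$ has a partite representation if it has a $k$-partite representation for some $k$. *)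

theory Defs
  imports Complex_Main "HOL-Library.Landau_Symbols" "HOL-Library.Disjoint_Sets"
begin

datatype 'a ugraph = Graph (verts: "'a set") (edges: "'a set set")

definition simple_graph :: "'a ugraph \<Rightarrow> bool" where
  "simple_graph G \<longleftrightarrow>
     finite (verts G) \<and> (\<forall>e\<in>edges G. e \<subseteq> verts G \<and> card e = 2)"

definition subgraph :: "'a ugraph \<Rightarrow> 'a ugraph \<Rightarrow> bool" where
  "subgraph H G \<longleftrightarrow> simple_graph H \<and> verts H \<subseteq> verts G \<and> edges H \<subseteq> edges G"

definition isomorphic :: "'a ugraph \<Rightarrow> 'b ugraph \<Rightarrow> bool" where
  "isomorphic G H \<longleftrightarrow>
     (\<exists>f. bij_betw f (verts G) (verts H) \<and> edges H = (\<lambda>e. f ` e) ` edges G)"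

definition induced_subgraph :: "'a ugraph \<Rightarrow> 'a set \<Rightarrow> 'a ugraph" where
  "induced_subgraph G W = Graph (verts G \<inter> W) {e \<in> edges G. e \<subseteq> W}"

definition delete_vertex :: "'a ugraph \<Rightarrow> 'a \<Rightarrow> 'a ugraph" where
  "delete_vertex G v = induced_subgraph G (verts G - {v})"

definition delete_edge :: "'a ugraph \<Rightarrow> 'a set \<Rightarrow> 'a ugraph" where
  "delete_edge G e = Graph (verts G) (edges G - {e})"

definition reachable :: "'a ugraph \<Rightarrow> 'a \<Rightarrow> 'a \<Rightarrow> bool" where
  "reachable G u v \<longleftrightarrow> (u, v) \<in> {(x, y). {x, y} \<in> edges G}\<^sup>*"

definition connected_graph :: "'a ugraph \<Rightarrow> bool" where
  "connected_graph G \<longleftrightarrow>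
     verts G \<noteq> {} \<and> (\<forall>u\<in>verts G. \<forall>v\<in>verts G. reachable G u v)"

text \<open>As usual, two-connected graphs have at least three vertices, so that a single edge is not
  two-connected.\<close>

definition two_connected :: "'a ugraph \<Rightarrow> bool" where
  "two_connected G \<longleftrightarrow>
     card (verts G) \<ge> 3 \<and> connected_graph G \<and>
     (\<forall>v\<in>verts G. connected_graph (delete_vertex G v))"

definition is_bridge :: "'a ugraph \<Rightarrow> 'a set \<Rightarrow> bool" where
  "is_bridge G e \<longleftrightarrow>
     e \<in> edges G \<and> (\<exists>u v. e = {u, v} \<and> \<not> reachable (delete_edge G e) u v)"

text \<open>A bridge counts as the subgraph formed by the edge and its two ends. An isolated vertex
  is not a block.\<close>

definition is_block :: "'a ugraph \<Rightarrow> 'a ugraph \<Rightarrow> bool" where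
  "is_block B G \<longleftrightarrow>
     (subgraph B G \<and> two_connected B \<and>
        (\<forall>B'. subgraph B' G \<and> two_connected B' \<and> subgraph B B' \<longrightarrow> B' = B)) \<or>
     (\<exists>e. is_bridge G e \<and> B = Graph e {e})"

text \<open>The size condition is written without subtraction: with truncated subtraction,
  \<open>card A = card B - 1\<close> would also hold for \<open>A = B = {}\<close>.\<close>

definition hypercube :: "nat \<Rightarrow> nat set ugraph" where
  "hypercube n = Graph (Pow {1..n})
     {{A, B} | A B. A \<subseteq> B \<and> B \<subseteq> {1..n} \<and> card B = card A + 1}"

definition vertex_layer :: "nat \<Rightarrow> nat \<Rightarrow> nat set set" where
  "vertex_layer n i = {A. A \<subseteq> {1..n} \<and> card A = i}"

text \<open>Only meaningful for \<open>1 \<le> i \<le> n\<close>.\<close>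

definition edge_layer :: "nat \<Rightarrow> nat \<Rightarrow> nat set ugraph" where
  "edge_layer n i =
     induced_subgraph (hypercube n) (vertex_layer n i \<union> vertex_layer n (i - 1))"

definition uniform_hypergraph :: "nat \<Rightarrow> 'a set \<Rightarrow> 'a set set \<Rightarrow> bool" where
  "uniform_hypergraph k X E \<longleftrightarrow> finite X \<and> (\<forall>e\<in>E. e \<subseteq> X \<and> card e = k)"

definition partite_hypergraph :: "nat \<Rightarrow> 'a set \<Rightarrow> 'a set set \<Rightarrow> bool" where
  "partite_hypergraph k X E \<longleftrightarrow>
     uniform_hypergraph k X E \<and>
     (\<exists>P :: nat \<Rightarrow> 'a set.
        disjoint_family_on P {1..k} \<and> (\<Union>i\<in>{1..k}. P i) = X \<and>
        (\<forall>e\<in>E. \<forall>i\<in>{1..k}. card (e \<inter> P i) = 1))"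

definition has_k_partite_representation :: "nat \<Rightarrow> 'a ugraph \<Rightarrow> bool" where
  "has_k_partite_representation k H \<longleftrightarrow>
     (\<exists>n H'. 1 \<le> k \<and> k \<le> n \<and> subgraph H' (edge_layer n k) \<and> isomorphic H H' \<and>
        (\<exists>X. partite_hypergraph k X (verts H' \<inter> vertex_layer n k)))"

definition has_partite_representation :: "'a ugraph \<Rightarrow> bool" where
  "has_partite_representation H \<longleftrightarrow> (\<exists>k. has_k_partite_representation k H)"

definition contains_copy :: "'b ugraph \<Rightarrow> 'a ugraph \<Rightarrow> bool" where
  "contains_copy G H \<longleftrightarrow> (\<exists>H'. subgraph H' G \<and> isomorphic H H')"

text \<open>For a simple graph \<open>Q\<close> the supremum ranges over a finite set, which is nonempty unless
  \<open>H\<close> has no vertices, so it is a maximum (see \<open>turan_ex_eq_Max\<close>).\<close>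

definition turan_ex :: "'b ugraph \<Rightarrow> 'a ugraph \<Rightarrow> nat" where
  "turan_ex Q H = Sup {card (edges G) | G. subgraph G Q \<and> \<not> contains_copy G H}"

definition zero_turan_density :: "'a ugraph \<Rightarrow> bool" where
  "zero_turan_density H \<longleftrightarrow>
     (\<lambda>n. real (turan_ex (hypercube n) H)) \<in> o(\<lambda>n. real (card (edges (hypercube n))))"

lemma simple_graph_hypercube: "simple_graph (hypercube n)"
proof -
  have "e \<subseteq> Pow {1..n} \<and> card e = 2" if e: "e \<in> edges (hypercube n)" for e
  proof -
    obtain A B where AB: "e = {A, B}" "A \<subseteq> B" "B \<subseteq> {1..n}" "card B = card A + 1"
      using e unfolding hypercube_def ugraph.sel by blast
    then have "A \<noteq> B" by (metis Suc_eq_plus1 n_not_Suc_n)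
    then have "card e = 2" using AB(1) by simp
    moreover have "e \<subseteq> Pow {1..n}" using AB by blast
    ultimately show ?thesis by blast
  qed
  then show ?thesis
    by (simp add: simple_graph_def) (simp add: hypercube_def)
qed

lemma turan_ex_eq_Max:
  fixes Q :: "'b ugraph"
  assumes Q: "simple_graph Q" and H: "verts H \<noteq> {}"
  shows "turan_ex Q H = Max {card (edges G) | G. subgraph G Q \<and> \<not> contains_copy G H}"
proof -
  let ?S = "{card (edges G) | G. subgraph G Q \<and> \<not> contains_copy G H}"
  have "edges Q \<subseteq> Pow (verts Q)" and "finite (Pow (verts Q))"
    using Q unfolding simple_graph_def by auto
  then have fin: "finite (edges Q)"
    by (rule finite_subset)
  have "card (edges G) \<le> card (edges Q)" if "subgraph G Q" for G
    using that unfolding subgraph_def by (intro card_mono[OF fin]) blast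
  then have "?S \<subseteq> {..card (edges Q)}"
    by blast
  then have finS: "finite ?S"
    by (rule finite_subset) simp
  have 1: "subgraph (Graph {} {}) Q"
    by (simp add: subgraph_def simple_graph_def)
  have 2: "\<not> contains_copy (Graph {} {} :: 'b ugraph) H"
    using H unfolding contains_copy_def subgraph_def isomorphic_def bij_betw_def by auto
  have "?S \<noteq> {}"
    using 1 2 by blast
  with finS show ?thesis
    unfolding turan_ex_def by (rule cSup_eq_Max)
qed

end

theory Submission
  imports Defs
begin

text \<open>
  Call a rooted graph unavoidable if every subgraph of \<open>Q\<^sub>n\<close> with at least \<open>\<gamma> n 2\<^sup>n\<close> edges, for \<open>n\<close>
  large, contains a copy of it whose root is a set of even size, and also one whose root is a set of
  odd size (\<open>unavoidable_at\<close>).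

  A graph without isolated vertices that has a partite representation is unavoidable for every
  root. The core is Conlon's argument: by double counting, a dense subgraph of \<open>Q\<^sub>n\<close> has a set \<open>S\<close> such that the \<open>k\<close>-sets \<open>Z\<close> for
  which all edges from \<open>S \<union> Z\<close> down to \<open>S \<union> Z - {w}\<close> are present form a dense \<open>k\<close>-uniform
  hypergraph. By Erdos's theorem this contains a large complete \<open>k\<close>-partite hypergraph, into which the
  partite representation is mapped (\<open>oriented_copy_in_dense\<close>). The copy keeps the orientation of
  the representation, so after passing to edges whose tops have one parity, the parity of the root
  is determined. The other parity is obtained by complementing all sets, an automorphism of \<open>Q\<^sub>n\<close>
  that reverses the orientation (\<open>unavoidable_at_if_partite\<close>).

  Two connected unavoidable graphs with a common root can be glued there
  (\<open>unavoidable_at_glue\<close>). In a dense graph, all but a small proportion of the edges have their end of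
  the prescribed parity at a vertex that is the root of a copy, for otherwise the remaining edges
  would contain one more copy. This alone would produce copies of the two parts with the same root,
  but they might intersect. So the directions of the cube are first split into two halves, one for
  each part. Copies that use disjoint sets of directions meet only in the root, and for a suitable
  split the vertices that have many edges in both halves still account for a positive proportion of
  all pairs of edges with a common end.

  By induction along the decomposition into blocks, every connected graph with the required blocks
  is unavoidable (\<open>connected_unavoidable\<close>). Further components are embedded one after the other,
  since deleting boundedly many vertices of \<open>Q\<^sub>n\<close> destroys only \<open>O(n)\<close> edges (\<open>dense_contains\<close>).
\<close>

section \<open>Double counting and complete partite hypergraphs\<close>

lemma ex_ge_average:
  fixes g :: "'z \<Rightarrow> real"
  assumes "finite Z" "Z \<noteq> {}" and avg: "K * real (card Z) \<le> (\<Sum>z\<in>Z. g z)"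
  shows "\<exists>z\<in>Z. K \<le> g z"
proof (rule ccontr)
  assume "\<not> ?thesis"
  then have "\<forall>z\<in>Z. g z < K" by force
  then have "sum g Z < (\<Sum>z\<in>Z. K)" using assms by (intro sum_strict_mono) auto
  with avg show False by (simp add: mult.commute)
qed

definition distinct_lists :: "nat \<Rightarrow> 'a set \<Rightarrow> 'a list set" where
  "distinct_lists t A = {zs. length zs = t \<and> distinct zs \<and> set zs \<subseteq> A}"

lemma finite_distinct_lists: "finite A \<Longrightarrow> finite (distinct_lists t A)"
  by (rule finite_subset[OF _ finite_lists_length_eq[of A t]]) (auto simp: distinct_lists_def)

lemma card_distinct_lists_le: "finite A \<Longrightarrow> card (distinct_lists t A) \<le> card A ^ t"
  using card_mono[OF finite_lists_length_eq[of A t], of "distinct_lists t A"]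
  by (auto simp: distinct_lists_def card_lists_length_eq)

lemma card_distinct_lists_ge:
  assumes "finite A"
  shows "(card A - t) ^ t \<le> card (distinct_lists t A)"
proof (cases "t \<le> card A")
  case True
  let ?I = "{card A - t + 1..card A}"
  have "(\<Prod>i\<in>?I. card A - t) \<le> (\<Prod>i\<in>?I. i)" by (rule prod_mono) auto
  then have "(card A - t) ^ t \<le> \<Prod>?I" using True by simp
  then show ?thesis
    using card_lists_distinct_length_eq[OF assms True] unfolding distinct_lists_def by simp
next
  case False then show ?thesis by (cases t) auto
qed

text \<open>A substitute for the power mean inequality with a cruder constant: a positive proportion of
  the sets \<open>N u\<close> have at least half the average size, and already these contribute lists of the
  order \<open>card V ^ t\<close>, because repetitions are negligible once \<open>t\<close> is small against \<open>card V\<close>. It is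
  applied below to the possible first entries of a tuple, to the directions going down from a
  vertex of the hypercube, and, with \<open>t = 2\<close>, to all directions at a vertex.\<close>

lemma many_distinct_lists:
  fixes N :: "'u \<Rightarrow> 'v set" and c :: real
  assumes fin: "finite U" "finite V" and ne: "V \<noteq> {}" and sub: "\<And>u. u \<in> U \<Longrightarrow> N u \<subseteq> V"
    and c: "c > 0" and dense: "c * real (card U) * real (card V) \<le> (\<Sum>u\<in>U. real (card (N u)))"
    and large: "4 * real t \<le> c * real (card V)"
  shows "c / 2 * (c / 4) ^ t * real (card U) * real (card V) ^ t
           \<le> (\<Sum>u\<in>U. real (card (distinct_lists t (N u))))"
proof -
  define n where "n = real (card V)"
  have n: "n > 0" using fin ne by (simp add: n_def card_gt_0_iff)
  define Big where "Big = {u\<in>U. c * n / 2 \<le> real (card (N u))}"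
  have finB: "finite Big" and BU: "Big \<subseteq> U" using fin by (auto simp: Big_def)
  have Nle: "real (card (N u)) \<le> n" if "u \<in> U" for u
    using card_mono[OF fin(2) sub[OF that]] by (simp add: n_def)
  have "(\<Sum>u\<in>U. real (card (N u)))
      = (\<Sum>u\<in>Big. real (card (N u))) + (\<Sum>u\<in>U - Big. real (card (N u)))"
    using sum.subset_diff[OF BU fin(1)] by (simp add: add.commute)
  also have "(\<Sum>u\<in>Big. real (card (N u))) \<le> real (card Big) * n"
    by (rule sum_bounded_above) (use BU Nle in auto)
  also have "(\<Sum>u\<in>U - Big. real (card (N u))) \<le> real (card (U - Big)) * (c * n / 2)"
    by (rule sum_bounded_above) (auto simp: Big_def)
  also have "real (card (U - Big)) * (c * n / 2) \<le> real (card U) * (c * n / 2)"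
    using c n fin by (intro mult_right_mono) (auto intro!: card_mono)
  finally have "c * real (card U) * n \<le> real (card Big) * n + real (card U) * (c * n / 2)"
    using dense unfolding n_def by linarith
  then have "(c / 2 * real (card U)) * n \<le> real (card Big) * n" by (simp add: algebra_simps)
  then have cardB: "c / 2 * real (card U) \<le> real (card Big)" using n by simp
  have lists: "(c / 4) ^ t * n ^ t \<le> real (card (distinct_lists t (N u)))" if u: "u \<in> Big" for u
  proof -
    have "finite (N u)" using u BU sub fin by (meson finite_subset subsetD)
    then have ge: "real ((card (N u) - t) ^ t) \<le> real (card (distinct_lists t (N u)))"
      using card_distinct_lists_ge of_nat_le_iff by blast
    have "c * n / 2 \<le> real (card (N u))" using u by (simp add: Big_def)
    then have "c / 4 * n \<le> real (card (N u) - t)" using large unfolding n_def by linarith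
    then have "(c / 4 * n) ^ t \<le> real (card (N u) - t) ^ t"
      using c n by (intro power_mono) auto
    also have "\<dots> \<le> real (card (distinct_lists t (N u)))" using ge by simp
    finally show ?thesis by (simp only: power_mult_distrib)
  qed
  have "c / 2 * (c / 4) ^ t * real (card U) * n ^ t = (c / 2 * real (card U)) * ((c / 4) ^ t * n ^ t)"
    by simp
  also have "\<dots> \<le> real (card Big) * ((c / 4) ^ t * n ^ t)"
    using cardB c n by (intro mult_right_mono) auto
  also have "\<dots> \<le> (\<Sum>u\<in>Big. real (card (distinct_lists t (N u))))"
    by (rule sum_bounded_below) (use lists in auto)
  also have "\<dots> \<le> (\<Sum>u\<in>U. real (card (distinct_lists t (N u))))"
    by (rule sum_mono2) (use fin BU in auto)
  finally show ?thesis unfolding n_def .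
qed

text \<open>Erdos's theorem that a dense \<open>k\<close>-uniform hypergraph contains a complete \<open>k\<close>-partite one, for
  ordered tuples. By induction on \<open>k\<close>: by double counting, some \<open>t\<close> first entries have a positive
  proportion of all \<open>(k - 1)\<close>-tuples as common continuations. These \<open>t\<close> entries form the first
  class, and the induction hypothesis applied to the common continuations gives the other classes.\<close>

lemma complete_partite_in_dense:
  fixes c :: real
  assumes "c > 0"
  shows "\<exists>N. \<forall>(V :: 'a set) R. finite V \<longrightarrow> N \<le> card V \<longrightarrow> R \<subseteq> {xs. length xs = k \<and> set xs \<subseteq> V} \<longrightarrow>
            c * real (card V) ^ k \<le> real (card R) \<longrightarrow>
            (\<exists>Ws. length Ws = k \<and> (\<forall>W\<in>set Ws. card W = t) \<and> (\<forall>xs. list_all2 (\<in>) xs Ws \<longrightarrow> xs \<in> R))"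
  using assms
proof (induction k arbitrary: c)
  case 0
  have "[] \<in> R" if "R \<subseteq> {xs. length xs = 0 \<and> set xs \<subseteq> V}"
    "c * real (card V) ^ 0 \<le> real (card R)" for R :: "'a list set" and V
  proof -
    have "R \<noteq> {}" using that 0 by auto
    then show ?thesis using that by auto
  qed
  then show ?case by auto
next
  case (Suc k)
  define c' where "c' = c / 2 * (c / 4) ^ t"
  have "c' > 0" using Suc.prems by (simp add: c'_def)
  from Suc.IH[OF this] obtain N where N: "\<forall>(V :: 'a set) R. finite V \<longrightarrow> N \<le> card V \<longrightarrow>
      R \<subseteq> {xs. length xs = k \<and> set xs \<subseteq> V} \<longrightarrow> c' * real (card V) ^ k \<le> real (card R) \<longrightarrow>
      (\<exists>Ws. length Ws = k \<and> (\<forall>W\<in>set Ws. card W = t) \<and> (\<forall>xs. list_all2 (\<in>) xs Ws \<longrightarrow> xs \<in> R))"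
    by (rule exE)
  define N' where "N' = Suc (max N (nat \<lceil>4 * real t / c\<rceil>))"
  show ?case
  proof (intro exI[of _ N'] allI impI)
    fix V :: "'a set" and R
    assume fin: "finite V" and card: "N' \<le> card V"
      and R: "R \<subseteq> {xs. length xs = Suc k \<and> set xs \<subseteq> V}"
      and dense: "c * real (card V) ^ Suc k \<le> real (card R)"
    define n where "n = real (card V)"
    have n: "n > 0" and NV: "N \<le> card V" and V: "V \<noteq> {}" using card by (auto simp: N'_def n_def)
    have "4 * real t / c \<le> n" using card unfolding N'_def n_def by linarith
    then have large: "4 * real t \<le> c * n" using Suc.prems by (simp add: field_simps)
    define U where "U = {ys. length ys = k \<and> set ys \<subseteq> V}"
    have "U = {ys. set ys \<subseteq> V \<and> length ys = k}" by (auto simp: U_def)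
    then have finU: "finite U" and cardU: "real (card U) = n ^ k"
      using fin by (auto simp: n_def card_lists_length_eq finite_lists_length_eq)
    define M where "M = (\<lambda>ys. {x\<in>V. x # ys \<in> R})"
    have finM: "finite (M ys)" for ys using fin by (simp add: M_def)
    have "R \<subseteq> (\<lambda>(ys, x). x # ys) ` Sigma U M"
    proof
      fix xs assume xs: "xs \<in> R"
      then obtain x ys where "xs = x # ys" using R by (cases xs) auto
      then show "xs \<in> (\<lambda>(ys, x). x # ys) ` Sigma U M"
        using xs R by (force simp: U_def M_def)
    qed
    then have "card R \<le> card (Sigma U M)"
      by (rule surj_card_le[rotated]) (use finU finM in auto)
    also have "\<dots> = (\<Sum>ys\<in>U. card (M ys))" using finU finM by simp
    finally have "real (card R) \<le> (\<Sum>ys\<in>U. real (card (M ys)))"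
      by (metis of_nat_le_iff of_nat_sum)
    then have "c * real (card U) * real (card V) \<le> (\<Sum>ys\<in>U. real (card (M ys)))"
      using dense cardU by (simp add: n_def algebra_simps)
    from many_distinct_lists[OF finU fin V _ Suc.prems this, of t]
    have many: "c' * n ^ k * n ^ t \<le> (\<Sum>ys\<in>U. real (card (distinct_lists t (M ys))))"
      using large cardU by (auto simp: M_def c'_def n_def)
    define Z where "Z = distinct_lists t V"
    define F where "F = (\<lambda>zs. {ys\<in>U. \<forall>z\<in>set zs. z # ys \<in> R})"
    have finZ: "finite Z" and finF: "finite (F zs)" for zs
      using finU finite_distinct_lists[OF fin] by (auto simp: F_def Z_def)
    have finD: "finite (distinct_lists t (M ys))" for ys using finite_distinct_lists[OF finM] .
    \<comment> \<open>The pairs of a continuation and a list of possible first entries, counted from the other side.\<close>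
    have "card (Sigma U (\<lambda>ys. distinct_lists t (M ys))) \<le> card (Sigma Z F)"
      by (rule card_inj_on_le[where f = prod.swap])
        (use finZ finF in \<open>auto simp: Z_def F_def distinct_lists_def M_def\<close>)
    then have "(\<Sum>ys\<in>U. card (distinct_lists t (M ys))) \<le> (\<Sum>zs\<in>Z. card (F zs))"
      using finU finD finZ finF by simp
    then have "(\<Sum>ys\<in>U. real (card (distinct_lists t (M ys)))) \<le> (\<Sum>zs\<in>Z. real (card (F zs)))"
      by (metis of_nat_le_iff of_nat_sum)
    then have tot: "c' * n ^ k * n ^ t \<le> (\<Sum>zs\<in>Z. real (card (F zs)))" using many by linarith
    have "real (card Z) \<le> n ^ t"
      using card_distinct_lists_le[OF fin, of t] unfolding Z_def n_def by (metis of_nat_le_iff of_nat_power)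
    then have "c' * n ^ k * real (card Z) \<le> c' * n ^ k * n ^ t"
      using \<open>c' > 0\<close> n by (intro mult_left_mono) auto
    moreover have "Z \<noteq> {}"
    proof
      assume "Z = {}"
      then have "c' * n ^ k * n ^ t \<le> 0" using tot by simp
      moreover have "c' * n ^ k * n ^ t > 0" using \<open>c' > 0\<close> n by simp
      ultimately show False by linarith
    qed
    ultimately obtain zs where zs: "zs \<in> Z" "c' * n ^ k \<le> real (card (F zs))"
      using ex_ge_average[OF finZ, of "c' * n ^ k" "\<lambda>zs. real (card (F zs))"] tot by auto
    have "F zs \<subseteq> {xs. length xs = k \<and> set xs \<subseteq> V}" by (auto simp: F_def U_def)
    from N[rule_format, OF fin NV this] zs(2) obtain Ws where Ws: "length Ws = k" "\<forall>W\<in>set Ws. card W = t"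
      "\<And>xs. list_all2 (\<in>) xs Ws \<Longrightarrow> xs \<in> F zs"
      unfolding n_def by blast
    have "card (set zs) = t" using zs(1) by (auto simp: Z_def distinct_lists_def distinct_card)
    moreover have "xs \<in> R" if "list_all2 (\<in>) xs (set zs # Ws)" for xs
      using that Ws(3) by (auto simp: list_all2_Cons2 F_def)
    ultimately show "\<exists>Ws. length Ws = Suc k \<and> (\<forall>W\<in>set Ws. card W = t) \<and>
        (\<forall>xs. list_all2 (\<in>) xs Ws \<longrightarrow> xs \<in> R)"
      using Ws by (intro exI[of _ "set zs # Ws"]) auto
  qed
qed

section \<open>The hypercube\<close>

definition flip :: "nat \<Rightarrow> nat set \<Rightarrow> nat set" where
  "flip d x = (if d \<in> x then x - {d} else insert d x)"

lemma flip_flip [simp]: "flip d (flip d x) = x"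
  by (auto simp: flip_def)

lemma flip_inject: "flip d x = flip d' x \<longleftrightarrow> d = d'"
  by (auto simp: flip_def split: if_splits)

lemma even_card_flip: "finite x \<Longrightarrow> even (card (flip d x)) \<longleftrightarrow> odd (card x)"
  by (auto simp: flip_def card_Diff_singleton_if card_gt_0_iff)

lemma hypercube_edge_down:
  assumes "e \<in> edges (hypercube n)"
  obtains A w where "A \<subseteq> {1..n}" "w \<in> A" "e = {A, A - {w}}"
proof -
  obtain A B where AB: "e = {A, B}" "A \<subseteq> B" "B \<subseteq> {1..n}" "card B = card A + 1"
    using assms unfolding hypercube_def ugraph.sel by blast
  have fin: "finite B" using AB finite_subset by blast
  then have "card (B - A) = 1" using AB by (simp add: card_Diff_subset finite_subset)
  then obtain w where "B - A = {w}" by (auto simp: card_1_singleton_iff)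
  then have "w \<in> B" "A = B - {w}" using AB by auto
  then show ?thesis using that AB by (metis insert_commute)
qed

lemma hypercube_edge_downI:
  assumes "A \<subseteq> {1..n}" "w \<in> A"
  shows "{A, A - {w}} \<in> edges (hypercube n)"
proof -
  have "finite A" using assms finite_subset by blast
  then have "card A = card (A - {w}) + 1" using assms by (metis Suc_eq_plus1 card_Suc_Diff1)
  then show ?thesis using assms unfolding hypercube_def ugraph.sel
    by (intro CollectI exI[of _ "A - {w}"] exI[of _ A]) auto
qed

lemma hypercube_edge_flipI:
  assumes "x \<subseteq> {1..n}" "d \<in> {1..n}"
  shows "{x, flip d x} \<in> edges (hypercube n)"
proof (cases "d \<in> x")
  case True then show ?thesis using hypercube_edge_downI[of x n d] assms by (simp add: flip_def)
next
  case False then show ?thesis using hypercube_edge_downI[of "insert d x" n d] assms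
    by (simp add: flip_def insert_commute)
qed

lemma hypercube_edge_at_parity:
  assumes "e \<in> edges (hypercube n)"
  obtains x d where "x \<subseteq> {1..n}" "d \<in> {1..n}" "e = {x, flip d x}" "even (card x) = p"
proof -
  obtain A w where A: "A \<subseteq> {1..n}" "w \<in> A" "e = {A, A - {w}}" using assms by (rule hypercube_edge_down)
  have e: "e = {A, flip w A}" using A by (simp add: flip_def)
  have w: "w \<in> {1..n}" using A by blast
  have fin: "finite A" using A finite_subset by blast
  show ?thesis
  proof (cases "even (card A) = p")
    case True then show ?thesis using that[of A w] A(1) e w by blast
  next
    case False
    show ?thesis
    proof (rule that[of "flip w A" w])
      show "flip w A \<subseteq> {1..n}" using A by (auto simp: flip_def)
      show "e = {flip w A, flip w (flip w A)}" using e by (simp add: insert_commute)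
      show "even (card (flip w A)) = p" using False even_card_flip[OF fin] by blast
    qed (fact w)
  qed
qed

lemma finite_edges_hypercube: "finite (edges (hypercube n))"
proof -
  have "edges (hypercube n) \<subseteq> Pow (Pow {1..n})"
    using simple_graph_hypercube[of n] unfolding simple_graph_def by (auto simp: hypercube_def)
  then show ?thesis by (rule finite_subset) simp
qed

lemma card_edges_hypercube_ge: "real n * 2 ^ n \<le> 2 * real (card (edges (hypercube n)))"
proof (cases n)
  case (Suc m)
  let ?S = "Sigma {1..n} (\<lambda>d. Pow ({1..n} - {d}))"
  have "inj_on (\<lambda>(d, A). {A, insert d A}) ?S"
  proof (rule inj_onI, clarsimp)
    fix d A d' A'
    assume "{A, insert d A} = {A', insert d' A'}" "A \<subseteq> {Suc 0..n} - {d}" "A' \<subseteq> {Suc 0..n} - {d'}"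
    then show "d = d' \<and> A = A'" by (auto simp: doubleton_eq_iff)
  qed
  moreover have "(\<lambda>(d, A). {A, insert d A}) ` ?S \<subseteq> edges (hypercube n)"
  proof clarify
    fix d A assume "d \<in> {1..n}" "A \<subseteq> {1..n} - {d}"
    moreover from this have "d \<notin> A" by blast
    ultimately show "{A, insert d A} \<in> edges (hypercube n)"
      using hypercube_edge_flipI[of A n d] unfolding flip_def by auto
  qed
  ultimately have "card ?S \<le> card (edges (hypercube n))"
    by (rule card_inj_on_le[OF _ _ finite_edges_hypercube])
  moreover have "card ?S = n * 2 ^ m"
    by (subst card_SigmaI) (auto simp: card_Pow Suc)
  ultimately have "n * 2 ^ m \<le> card (edges (hypercube n))" by metis
  then have "real (n * 2 ^ m) \<le> real (card (edges (hypercube n)))" by (rule of_nat_mono)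
  then show ?thesis by (simp add: Suc algebra_simps)
qed simp

text \<open>The images of the vertices need not lie in the vertex set of a host graph: for a graph
  without isolated vertices this follows, and otherwise it is required separately.\<close>

definition embeds :: "('a \<Rightarrow> 'b) \<Rightarrow> 'a ugraph \<Rightarrow> 'b set set \<Rightarrow> bool" where
  "embeds f H E \<longleftrightarrow> inj_on f (verts H) \<and> (\<forall>e\<in>edges H. f ` e \<in> E)"

text \<open>Prescribing the parity of the image of the root is what makes two copies with a common root
  possible. Without it, in a graph all of whose edges lie in layers of one parity, the copies of
  one part might have their root always at the top of a layer, and those of the other part always
  at the bottom.\<close>

definition unavoidable_at :: "'a ugraph \<Rightarrow> 'a \<Rightarrow> bool" where
  "unavoidable_at H r \<longleftrightarrow> (\<forall>p. \<forall>\<gamma>>0. \<exists>N. \<forall>n\<ge>N. \<forall>E\<subseteq>edges (hypercube n).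
     \<gamma> * real n * 2 ^ n \<le> real (card E) \<longrightarrow> (\<exists>f. embeds f H E \<and> even (card (f r)) = p))"

section \<open>Graphs with a partite representation\<close>

lemma dense_hypercube_down_degrees:
  assumes E: "E \<subseteq> edges (hypercube n)"
  shows "card E \<le> (\<Sum>A\<in>Pow {1..n}. card {w\<in>A. {A, A - {w}} \<in> E})"
proof -
  let ?S = "Sigma (Pow {1..n}) (\<lambda>A. {w\<in>A. {A, A - {w}} \<in> E})"
  have fin: "finite A" if "A \<in> Pow {1..n}" for A :: "nat set" using that finite_subset by blast
  have "E \<subseteq> (\<lambda>(A, w). {A, A - {w}}) ` ?S"
  proof
    fix e assume e: "e \<in> E"
    obtain A w where "A \<subseteq> {1..n}" "w \<in> A" "e = {A, A - {w}}"
      using e E hypercube_edge_down by (metis subsetD)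
    then show "e \<in> (\<lambda>(A, w). {A, A - {w}}) ` ?S" using e by (intro image_eqI[of _ _ "(A, w)"]) auto
  qed
  moreover have "finite ?S" using fin by (intro finite_SigmaI) auto
  ultimately have "card E \<le> card ?S" by (meson card_mono card_image_le finite_imageI le_trans)
  also have "\<dots> = (\<Sum>A\<in>Pow {1..n}. card {w\<in>A. {A, A - {w}} \<in> E})"
    using fin by (intro card_SigmaI) auto
  finally show ?thesis .
qed

text \<open>Conlon's reduction to hypergraphs. A vertex \<open>A\<close> with many edges of \<open>E\<close> going down from it
  has many \<open>k\<close>-subsets \<open>Z\<close> such that all \<open>k\<close> edges from \<open>A\<close> to \<open>A - {w}\<close>, \<open>w \<in> Z\<close>, belong to \<open>E\<close>.
  Writing \<open>A = S \<union> Z\<close> and fixing the most popular \<open>S\<close> gives a dense \<open>k\<close>-uniform hypergraph of such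
  sets \<open>Z\<close>, hence a complete \<open>k\<close>-partite one with classes \<open>Ws\<close>. The classes are automatically
  disjoint, since all transversals consist of distinct entries.\<close>

lemma dense_contains_blown_up_star:
  fixes \<gamma> :: real
  assumes \<gamma>: "\<gamma> > 0"
  shows "\<exists>N. \<forall>n\<ge>N. \<forall>E\<subseteq>edges (hypercube n). \<gamma> * real n * 2 ^ n \<le> real (card E) \<longrightarrow>
    (\<exists>S Ws. length Ws = k \<and> (\<forall>W\<in>set Ws. card W = t) \<and>
       (\<forall>zs. list_all2 (\<in>) zs Ws \<longrightarrow> distinct zs \<and> set zs \<inter> S = {} \<and>
          (\<forall>w\<in>set zs. {S \<union> set zs, (S \<union> set zs) - {w}} \<in> E)))"
proof -
  define c where "c = \<gamma> / 2 * (\<gamma> / 4) ^ k"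
  have c: "c > 0" using \<gamma> by (simp add: c_def)
  from complete_partite_in_dense[OF c, of k t, where 'a = nat] obtain N where
    N: "\<forall>(V :: nat set) R. finite V \<longrightarrow> N \<le> card V \<longrightarrow> R \<subseteq> {xs. length xs = k \<and> set xs \<subseteq> V} \<longrightarrow>
            c * real (card V) ^ k \<le> real (card R) \<longrightarrow>
            (\<exists>Ws. length Ws = k \<and> (\<forall>W\<in>set Ws. card W = t) \<and> (\<forall>xs. list_all2 (\<in>) xs Ws \<longrightarrow> xs \<in> R))"
    by (rule exE)
  define N' where "N' = Suc (max N (nat \<lceil>4 * real k / \<gamma>\<rceil>))"
  show ?thesis
  proof (intro exI[of _ N'] allI impI)
    fix n E assume n: "n \<ge> N'" and E: "E \<subseteq> edges (hypercube n)"
      and dense: "\<gamma> * real n * 2 ^ n \<le> real (card E)"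
    define U where "U = Pow {1..n}"
    define M where "M = (\<lambda>A. {w\<in>A. {A, A - {w}} \<in> E})"
    have finU: "finite U" and cardU: "card U = 2 ^ n" by (auto simp: U_def card_Pow)
    have subM: "M A \<subseteq> {1..n}" if "A \<in> U" for A using that by (auto simp: M_def U_def)
    have finM: "finite (M A)" if "A \<in> U" for A using subM[OF that] finite_subset by blast
    have "4 * real k / \<gamma> \<le> real n" using n unfolding N'_def by linarith
    then have large: "4 * real k \<le> \<gamma> * real (card {1..n})" using \<gamma> by (simp add: field_simps)
    have "real (card E) \<le> real (\<Sum>A\<in>U. card (M A))"
      using dense_hypercube_down_degrees[OF E] unfolding U_def M_def by (rule of_nat_mono)
    then have "\<gamma> * real (card U) * real (card {1..n}) \<le> (\<Sum>A\<in>U. real (card (M A)))"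
      using dense cardU by (simp add: algebra_simps)
    from many_distinct_lists[OF finU _ _ subM \<gamma> this large]
    have many: "c * 2 ^ n * real n ^ k \<le> (\<Sum>A\<in>U. real (card (distinct_lists k (M A))))"
      using cardU n by (auto simp: c_def N'_def)
    define R where "R = (\<lambda>S. {zs. length zs = k \<and> distinct zs \<and> set zs \<subseteq> {1..n} \<and> set zs \<inter> S = {} \<and>
      (\<forall>w\<in>set zs. {S \<union> set zs, (S \<union> set zs) - {w}} \<in> E)})"
    have Rsub: "R S \<subseteq> {xs. length xs = k \<and> set xs \<subseteq> {1..n}}" for S by (auto simp: R_def)
    have finR: "finite (R S)" for S
      by (rule finite_subset[OF _ finite_lists_length_eq[of "{1..n}" k]]) (auto simp: R_def)
    \<comment> \<open>Grouping by \<open>S\<close> loses nothing, since \<open>A\<close> is the union of \<open>S\<close> and the entries of the list.\<close>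
    have "card (Sigma U (\<lambda>A. distinct_lists k (M A))) \<le> card (Sigma U R)"
    proof (rule card_inj_on_le[where f = "\<lambda>(A, zs). (A - set zs, zs)"])
      show "inj_on (\<lambda>(A, zs). (A - set zs, zs)) (Sigma U (\<lambda>A. distinct_lists k (M A)))"
      proof (rule inj_onI, clarsimp simp: distinct_lists_def M_def)
        fix A B and zs :: "nat list"
        assume "A - set zs = B - set zs" "set zs \<subseteq> {w\<in>A. {A, A - {w}} \<in> E}"
          "set zs \<subseteq> {w\<in>B. {B, B - {w}} \<in> E}"
        then show "A = B" by blast
      qed
      show "(\<lambda>(A, zs). (A - set zs, zs)) ` Sigma U (\<lambda>A. distinct_lists k (M A)) \<subseteq> Sigma U R"
      proof clarify
        fix A zs assume A: "A \<in> U" and zs: "zs \<in> distinct_lists k (M A)"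
        then have "set zs \<subseteq> A" and Un: "A - set zs \<union> set zs = A" by (auto simp: distinct_lists_def M_def)
        then show "A - set zs \<in> U \<and> zs \<in> R (A - set zs)"
          using A zs unfolding R_def mem_Collect_eq Un by (auto simp: distinct_lists_def M_def U_def)
      qed
    qed (use finU finR in auto)
    then have "(\<Sum>A\<in>U. card (distinct_lists k (M A))) \<le> (\<Sum>S\<in>U. card (R S))"
      using finU finR finM by (simp add: finite_distinct_lists)
    then have "real (\<Sum>A\<in>U. card (distinct_lists k (M A))) \<le> real (\<Sum>S\<in>U. card (R S))"
      by (rule of_nat_mono)
    then have "c * real n ^ k * real (card U) \<le> (\<Sum>S\<in>U. real (card (R S)))"
      using many cardU by (simp add: algebra_simps)
    from ex_ge_average[OF finU _ this] obtain S where "c * real n ^ k \<le> real (card (R S))"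
      by (auto simp: U_def)
    moreover have "N \<le> card {1..n}" using n by (simp add: N'_def)
    ultimately have "\<exists>Ws. length Ws = k \<and> (\<forall>W\<in>set Ws. card W = t) \<and> (\<forall>xs. list_all2 (\<in>) xs Ws \<longrightarrow> xs \<in> R S)"
      using N[rule_format, OF _ _ Rsub[of S]] by simp
    then obtain Ws where "length Ws = k" "\<forall>W\<in>set Ws. card W = t" "\<forall>xs. list_all2 (\<in>) xs Ws \<longrightarrow> xs \<in> R S"
      by blast
    then show "\<exists>S Ws. length Ws = k \<and> (\<forall>W\<in>set Ws. card W = t) \<and>
       (\<forall>zs. list_all2 (\<in>) zs Ws \<longrightarrow> distinct zs \<and> set zs \<inter> S = {} \<and>
          (\<forall>w\<in>set zs. {S \<union> set zs, (S \<union> set zs) - {w}} \<in> E))"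
      by (intro exI[of _ S] exI[of _ Ws]) (auto simp: R_def)
  qed
qed

lemma transversal_through_two:
  assumes "i < length Ws" "j < length Ws" "i \<noteq> j" "a \<in> Ws ! i" "b \<in> Ws ! j" "\<forall>W\<in>set Ws. W \<noteq> {}"
  shows "\<exists>zs. list_all2 (\<in>) zs Ws \<and> zs ! i = a \<and> zs ! j = b \<and> length zs = length Ws"
proof -
  let ?zs = "map (\<lambda>m. if m = i then a else if m = j then b else SOME w. w \<in> Ws ! m) [0..<length Ws]"
  have "(SOME w. w \<in> Ws ! m) \<in> Ws ! m" if "m < length Ws" for m
    using assms(6) that by (simp add: some_in_eq)
  then have "list_all2 (\<in>) ?zs Ws" using assms by (auto simp: list_all2_conv_all_nth)
  then show ?thesis using assms by (intro exI[of _ ?zs]) auto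
qed

text \<open>Conlon's theorem, with the orientation of the copy recorded. Given the blown-up star with base
  \<open>S\<close> and classes \<open>Ws\<close>, map the \<open>i\<close>th part of the ground set of the representation injectively
  into the \<open>i\<close>th class and send a vertex \<open>u\<close> to the union of \<open>S\<close> and the image of its set. A vertex
  in the top layer of the representation becomes \<open>S\<close> plus a transversal, so each edge of \<open>B\<close>
  becomes one of the edges of the blown-up star. The set \<open>top\<close> depends only on the representation:
  it consists of the vertices whose neighbours are all mapped below them.\<close>

lemma oriented_copy_in_dense:
  fixes B :: "'a ugraph"
  assumes B: "simple_graph B" and rep: "has_partite_representation B"
    and iso: "\<And>u. u \<in> verts B \<Longrightarrow> \<exists>w. {u, w} \<in> edges B"
  obtains top where "\<And>\<gamma>. \<gamma> > 0 \<Longrightarrow> \<exists>N. \<forall>n\<ge>N. \<forall>E\<subseteq>edges (hypercube n).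
     \<gamma> * real n * 2 ^ n \<le> real (card E) \<longrightarrow> (\<exists>f. embeds f B E \<and>
       (\<forall>u w. {u, w} \<in> edges B \<longrightarrow> (if u \<in> top then f w \<subset> f u else f u \<subset> f w)))"
proof -
  obtain k n0 H' X where k: "1 \<le> k" "k \<le> n0" and H': "subgraph H' (edge_layer n0 k)"
    and isoH: "isomorphic B H'" and part: "partite_hypergraph k X (verts H' \<inter> vertex_layer n0 k)"
    using rep unfolding has_partite_representation_def has_k_partite_representation_def by blast
  obtain g where g: "bij_betw g (verts B) (verts H')" and gE: "edges H' = (\<lambda>e. g ` e) ` edges B"
    using isoH unfolding isomorphic_def by blast
  obtain P :: "nat \<Rightarrow> nat set" where P: "disjoint_family_on P {1..k}" "(\<Union>i\<in>{1..k}. P i) = X"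
      "\<forall>e\<in>verts H' \<inter> vertex_layer n0 k. \<forall>i\<in>{1..k}. card (e \<inter> P i) = 1"
    and hyper: "finite X" "\<forall>e\<in>verts H' \<inter> vertex_layer n0 k. e \<subseteq> X \<and> card e = k"
    using part unfolding partite_hypergraph_def uniform_hypergraph_def by blast
  have simple: "\<forall>e\<in>edges H'. e \<subseteq> verts H'" using H' unfolding subgraph_def simple_graph_def by blast
  have edge: "\<exists>a b x. x \<in> g a \<and> {a, b} = {u, w} \<and> g b = g a - {x} \<and> card (g a) = k \<and> card (g b) \<noteq> k
        \<and> g a \<in> verts H' \<inter> vertex_layer n0 k" if uw: "{u, w} \<in> edges B" for u w
  proof -
    have "g ` {u, w} \<in> edges H'" using gE uw by blast
    then have e: "{g u, g w} \<in> edges H'" by simp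
    then have cube: "{g u, g w} \<in> edges (hypercube n0)"
      and sub: "{g u, g w} \<subseteq> vertex_layer n0 k \<union> vertex_layer n0 (k - 1)"
      using H' unfolding subgraph_def edge_layer_def induced_subgraph_def by auto
    from cube obtain A x where A: "A \<subseteq> {1..n0}" "x \<in> A" "{g u, g w} = {A, A - {x}}"
      by (rule hypercube_edge_down)
    have finA: "finite A" using A(1) finite_subset by blast
    have "card A > 0" and cd: "card (A - {x}) = card A - 1" using A(2) finA by (auto simp: card_gt_0_iff)
    moreover have "card A = k \<or> card A = k - 1" "card (A - {x}) = k \<or> card (A - {x}) = k - 1"
      using sub unfolding vertex_layer_def A(3) by auto
    ultimately have card: "card A = k" "card (A - {x}) \<noteq> k" using k by linarith+
    have "A \<in> verts H'" using e simple unfolding A(3) by blast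
    then have "A \<in> verts H' \<inter> vertex_layer n0 k" using A(1) card by (simp add: vertex_layer_def)
    moreover have "\<exists>a b. {a, b} = {u, w} \<and> g a = A \<and> g b = A - {x}"
      using A(3) unfolding doubleton_eq_iff by blast
    ultimately show ?thesis using card A(2) by metis
  qed
  have gX: "g u \<subseteq> X" if u: "u \<in> verts B" for u
  proof -
    obtain w where "{u, w} \<in> edges B" using iso[OF u] by blast
    then obtain a b x where "x \<in> g a" "{a, b} = {u, w}" "g b = g a - {x}" "g a \<in> verts H' \<inter> vertex_layer n0 k"
      using edge by meson
    moreover from this have "u = a \<or> u = b" "g a \<subseteq> X" using hyper(2) unfolding doubleton_eq_iff by blast+
    ultimately show ?thesis by blast
  qed
  define pt where "pt = (\<lambda>x. SOME i. i \<in> {1..k} \<and> x \<in> P i)"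
  have pt: "pt x \<in> {1..k} \<and> x \<in> P (pt x)" if "x \<in> X" for x
    unfolding pt_def by (rule someI_ex) (use that P in blast)
  have pt_eq: "pt x = i" if "x \<in> P i" "i \<in> {1..k}" for x i
  proof (rule ccontr)
    assume "pt x \<noteq> i"
    moreover have "x \<in> X" using that P by blast
    ultimately show False using P(1) pt[of x] that unfolding disjoint_family_on_def by blast
  qed
  show ?thesis
  proof (rule that[of "{u. card (g u) = k}"])
    fix \<gamma> :: real assume "\<gamma> > 0"
    \<comment> \<open>Large enough for every part, and positive, so that the classes are nonempty.\<close>
    define t where "t = Suc (card X)"
    obtain N where N: "\<forall>n\<ge>N. \<forall>E\<subseteq>edges (hypercube n). \<gamma> * real n * 2 ^ n \<le> real (card E) \<longrightarrow>
      (\<exists>S Ws. length Ws = k \<and> (\<forall>W\<in>set Ws. card W = t) \<and>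
         (\<forall>zs. list_all2 (\<in>) zs Ws \<longrightarrow> distinct zs \<and> set zs \<inter> S = {} \<and>
            (\<forall>w\<in>set zs. {S \<union> set zs, (S \<union> set zs) - {w}} \<in> E)))"
      using dense_contains_blown_up_star[OF \<open>\<gamma> > 0\<close>, of k t] by (rule exE)
    show "\<exists>N. \<forall>n\<ge>N. \<forall>E\<subseteq>edges (hypercube n). \<gamma> * real n * 2 ^ n \<le> real (card E) \<longrightarrow>
      (\<exists>f. embeds f B E \<and> (\<forall>u w. {u, w} \<in> edges B \<longrightarrow>
         (if u \<in> {u. card (g u) = k} then f w \<subset> f u else f u \<subset> f w)))"
    proof (intro exI[of _ N] allI impI)
      fix n E assume "n \<ge> N" "E \<subseteq> edges (hypercube n)" "\<gamma> * real n * 2 ^ n \<le> real (card E)"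
      then obtain S Ws where Ws: "length Ws = k" "\<forall>W\<in>set Ws. card W = t"
        and trans: "\<And>zs. list_all2 (\<in>) zs Ws \<Longrightarrow> distinct zs \<and> set zs \<inter> S = {} \<and>
          (\<forall>w\<in>set zs. {S \<union> set zs, (S \<union> set zs) - {w}} \<in> E)"
        using N by blast
      have ne: "\<forall>W\<in>set Ws. W \<noteq> {}" using Ws(2) by (auto simp: t_def)
      have "\<exists>h. inj_on h (P i) \<and> h ` P i \<subseteq> Ws ! (i - 1)" if i: "i \<in> {1..k}" for i
      proof -
        have cardW: "card (Ws ! (i - 1)) = t" using Ws i by auto
        then have finW: "finite (Ws ! (i - 1))" by (metis card.infinite nat.distinct(1) t_def)
        have "P i \<subseteq> X" using P(2) i by blast
        then have finP: "finite (P i)" and "card (P i) \<le> card X"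
          using hyper(1) by (auto intro: finite_subset card_mono)
        then have "card (P i) \<le> card (Ws ! (i - 1))" using cardW by (simp add: t_def)
        then show ?thesis using inj_on_iff_card_le[OF finP finW] by blast
      qed
      then obtain h where h: "\<And>i. i \<in> {1..k} \<Longrightarrow> inj_on (h i) (P i) \<and> h i ` P i \<subseteq> Ws ! (i - 1)"
        by metis
      define \<phi> where "\<phi> = (\<lambda>x. h (pt x) x)"
      have \<phi>W: "\<phi> x \<in> Ws ! (pt x - 1)" if "x \<in> X" for x
        using h[of "pt x"] pt[OF that] by (auto simp: \<phi>_def)
      have inj: "inj_on \<phi> X"
      proof (rule inj_onI)
        fix x y assume xy: "x \<in> X" "y \<in> X" "\<phi> x = \<phi> y"
        have "pt x = pt y"
        proof (rule ccontr)
          assume ne': "pt x \<noteq> pt y"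
          have lt: "pt x - 1 < length Ws" "pt y - 1 < length Ws" "pt x - 1 \<noteq> pt y - 1"
            using pt[OF xy(1)] pt[OF xy(2)] ne' Ws(1) by auto
          \<comment> \<open>Two classes with a common element would have a transversal with a repeated entry.\<close>
          from transversal_through_two[OF lt \<phi>W[OF xy(1)] \<phi>W[OF xy(2)] ne]
          obtain zs where zs: "list_all2 (\<in>) zs Ws" "zs ! (pt x - 1) = zs ! (pt y - 1)"
              "length zs = length Ws"
            using xy(3) by auto
          then show False using trans[OF zs(1)] lt by (metis nth_eq_iff_index_eq)
        qed
        moreover have "inj_on (h (pt x)) (P (pt x))" "x \<in> P (pt x)" "y \<in> P (pt y)"
          using h pt xy(1,2) by auto
        ultimately show "x = y" using xy(3) by (simp add: \<phi>_def inj_on_eq_iff)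
      qed
      have up: "\<exists>zs. list_all2 (\<in>) zs Ws \<and> set zs = \<phi> ` e" if e: "e \<in> verts H' \<inter> vertex_layer n0 k" for e
      proof -
        have "\<exists>x. e \<inter> P i = {x}" if i: "i \<in> {1..k}" for i
        proof -
          have "card (e \<inter> P i) = 1" using P(3) e i by blast
          then show ?thesis by (simp add: card_1_singleton_iff)
        qed
        then obtain x where x: "\<And>i. i \<in> {1..k} \<Longrightarrow> e \<inter> P i = {x i}" by metis
        let ?zs = "map (\<lambda>m. \<phi> (x (Suc m))) [0..<k]"
        have x': "x i \<in> e \<and> x i \<in> X \<and> pt (x i) = i" if "i \<in> {1..k}" for i
          using x[OF that] pt_eq[of "x i" i] that hyper(2) e by blast
        have "list_all2 (\<in>) ?zs Ws"
          unfolding list_all2_conv_all_nth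
        proof (intro conjI allI impI)
          fix m assume "m < length ?zs"
          then show "?zs ! m \<in> Ws ! m" using x'[of "Suc m"] \<phi>W[of "x (Suc m)"] by auto
        qed (use Ws in simp)
        moreover have "set ?zs = \<phi> ` e"
        proof
          show "set ?zs \<subseteq> \<phi> ` e" using x' by auto
          show "\<phi> ` e \<subseteq> set ?zs"
          proof
            fix z assume "z \<in> \<phi> ` e"
            then obtain y where y: "y \<in> e" "z = \<phi> y" by blast
            then have "y \<in> X" using hyper(2) e by blast
            then have "y = x (pt y)" and "pt y \<in> {1..k}" using x[of "pt y"] pt y by auto
            moreover from this have "Suc (pt y - 1) = pt y" "pt y - 1 < k" by auto
            ultimately have "z = (\<lambda>m. \<phi> (x (Suc m))) (pt y - 1)" "pt y - 1 \<in> set [0..<k]"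
              using y by auto
            then show "z \<in> set ?zs" unfolding set_map by (rule image_eqI)
          qed
        qed
        ultimately show ?thesis by blast
      qed
      have S: "\<phi> x \<notin> S" if x: "x \<in> X" for x
      proof -
        let ?i = "pt x - 1"
        let ?zs = "map (\<lambda>m. if m = ?i then \<phi> x else SOME w. w \<in> Ws ! m) [0..<k]"
        have some: "(SOME w. w \<in> Ws ! m) \<in> Ws ! m" if "m < length Ws" for m
          using ne that by (simp add: some_in_eq)
        have zs: "list_all2 (\<in>) ?zs Ws" unfolding list_all2_conv_all_nth
          using \<phi>W[OF x] Ws(1) some by simp
        have "?i < k" using pt[OF x] by auto
        then have "\<phi> x \<in> set ?zs" by auto
        then show ?thesis using trans[OF zs] by blast
      qed
      define f where "f = (\<lambda>u. S \<union> \<phi> ` g u)"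
      have f_inv: "f u - S = \<phi> ` g u" if "u \<in> verts B" for u using gX[OF that] S by (auto simp: f_def)
      have "inj_on f (verts B)"
      proof (rule inj_onI)
        fix u w assume uw: "u \<in> verts B" "w \<in> verts B" "f u = f w"
        then have "\<phi> ` g u = \<phi> ` g w" using f_inv by metis
        then have "g u = g w" using inj gX uw by (simp add: inj_on_image_eq_iff)
        then show "u = w" using g uw by (auto simp: bij_betw_def inj_on_def)
      qed
      moreover have "{f u, f w} \<in> E \<and> (if u \<in> {u. card (g u) = k} then f w \<subset> f u else f u \<subset> f w)"
        if uw: "{u, w} \<in> edges B" for u w
      proof -
        obtain a b x where ab: "x \<in> g a" "{a, b} = {u, w}" "g b = g a - {x}" "card (g a) = k"
          "card (g b) \<noteq> k" "g a \<in> verts H' \<inter> vertex_layer n0 k"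
          using edge[OF uw] by (elim exE conjE) blast
        obtain zs where zs: "list_all2 (\<in>) zs Ws" "set zs = \<phi> ` g a" using up ab(6) by blast
        have aX: "g a \<subseteq> X" using hyper(2) ab(6) by blast
        then have x: "x \<in> X" "\<phi> x \<notin> S" using ab(1) S by auto
        have "\<phi> ` g b = \<phi> ` g a - {\<phi> x}" unfolding ab(3) using inj_on_image_set_diff[OF inj, of "g a" "{x}"] aX x
          by auto
        then have fb: "f b = f a - {\<phi> x}" using x by (auto simp: f_def)
        have fx: "\<phi> x \<in> f a" using ab(1) by (auto simp: f_def)
        have fa: "f a = S \<union> \<phi> ` g a" by (simp add: f_def)
        have "{f a, f b} \<in> E" using trans[OF zs(1)] zs(2) ab(1) unfolding fb fa by auto
        moreover have "f b \<subset> f a" using fb fx by auto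
        moreover have "u = a \<and> w = b \<or> u = b \<and> w = a" using ab(2) unfolding doubleton_eq_iff by blast
        ultimately show ?thesis using ab(4,5) by (elim disjE) (simp_all add: insert_commute)
      qed
      moreover from this have "f ` e \<in> E" if "e \<in> edges B" for e
        using that B unfolding simple_graph_def by (fastforce simp: card_2_iff)
      ultimately show "\<exists>f. embeds f B E \<and> (\<forall>u w. {u, w} \<in> edges B \<longrightarrow>
         (if u \<in> {u. card (g u) = k} then f w \<subset> f u else f u \<subset> f w))"
        unfolding embeds_def by blast
    qed
  qed
qed

text \<open>The edges whose upper ends have a fixed parity form a dense subgraph for one of the two
  parities, and there an oriented copy determines the parity of its root. If this is the wrong
  parity, look for the copy after complementing all sets: the subgraph stays dense, and
  complementing back turns the copy upside down, which moves the root to the other parity.\<close>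

lemma unavoidable_at_if_partite:
  fixes B :: "'a ugraph"
  assumes B: "simple_graph B" "has_partite_representation B"
    and iso: "\<And>u. u \<in> verts B \<Longrightarrow> \<exists>w. {u, w} \<in> edges B" and r: "r \<in> verts B"
  shows "unavoidable_at B r"
proof -
  obtain top where top: "\<And>\<gamma>. \<gamma> > 0 \<Longrightarrow> \<exists>N. \<forall>n\<ge>N. \<forall>E\<subseteq>edges (hypercube n).
     \<gamma> * real n * 2 ^ n \<le> real (card E) \<longrightarrow> (\<exists>f. embeds f B E \<and>
       (\<forall>u w. {u, w} \<in> edges B \<longrightarrow> (if u \<in> top then f w \<subset> f u else f u \<subset> f w)))"
    using oriented_copy_in_dense[OF B iso] by blast
  obtain s where s: "{r, s} \<in> edges B" using iso[OF r] by blast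
  show ?thesis
    unfolding unavoidable_at_def
  proof (intro allI impI)
    fix p and \<gamma> :: real assume "\<gamma> > 0"
    then have "\<gamma> / 2 > 0" by simp
    from top[OF this] obtain N where N: "\<forall>n\<ge>N. \<forall>E\<subseteq>edges (hypercube n).
       \<gamma> / 2 * real n * 2 ^ n \<le> real (card E) \<longrightarrow> (\<exists>f. embeds f B E \<and>
         (\<forall>u w. {u, w} \<in> edges B \<longrightarrow> (if u \<in> top then f w \<subset> f u else f u \<subset> f w)))"
      by (rule exE)
    show "\<exists>N. \<forall>n\<ge>N. \<forall>E\<subseteq>edges (hypercube n).
       \<gamma> * real n * 2 ^ n \<le> real (card E) \<longrightarrow> (\<exists>f. embeds f B E \<and> even (card (f r)) = p)"
    proof (intro exI[of _ N] allI impI)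
      fix n E assume n: "n \<ge> N" and E: "E \<subseteq> edges (hypercube n)"
        and dense: "\<gamma> * real n * 2 ^ n \<le> real (card E)"
      define T where "T = (\<lambda>q. {e\<in>E. \<exists>A w. w \<in> A \<and> A \<subseteq> {1..n} \<and> e = {A, A - {w}} \<and> even (card A) = q})"
      have finE: "finite E" using E finite_edges_hypercube finite_subset by blast
      have "E \<subseteq> T True \<union> T False"
      proof
        fix e assume e: "e \<in> E"
        then have "e \<in> edges (hypercube n)" using E by blast
        then obtain A w where "A \<subseteq> {1..n}" "w \<in> A" "e = {A, A - {w}}" by (rule hypercube_edge_down)
        then show "e \<in> T True \<union> T False" using e unfolding T_def by blast
      qed
      then have "card E \<le> card (T True \<union> T False)"
        using finE by (intro card_mono) (auto simp: T_def)
      also have "\<dots> \<le> card (T True) + card (T False)" by (rule card_Un_le)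
      finally have "\<exists>q. \<gamma> / 2 * real n * 2 ^ n \<le> real (card (T q))"
      proof -
        assume "card E \<le> card (T True) + card (T False)"
        then have "real (card E) \<le> real (card (T True)) + real (card (T False))" by linarith
        then have "\<gamma> / 2 * real n * 2 ^ n \<le> real (card (T True)) \<or> \<gamma> / 2 * real n * 2 ^ n \<le> real (card (T False))"
          using dense by argo
        then show ?thesis by blast
      qed
      then obtain q where q: "\<gamma> / 2 * real n * 2 ^ n \<le> real (card (T q))" ..
      have TE: "T q \<subseteq> E" by (auto simp: T_def)
      have parity: "even (card x) = q \<and> y \<subset> x \<or> even (card x) \<noteq> q \<and> x \<subset> y" if xy: "{x, y} \<in> T q" for x y
      proof -
        obtain A w where A: "w \<in> A" "A \<subseteq> {1..n}" "{x, y} = {A, A - {w}}" "even (card A) = q"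
          using xy unfolding T_def mem_Collect_eq by (elim exE conjE) (rule that)
        have "finite A" using A(2) finite_subset by blast
        then have "even (card (A - {w})) \<noteq> q" using A(1,4) even_card_flip[of A w] by (simp add: flip_def)
        moreover have "x = A \<and> y = A - {w} \<or> x = A - {w} \<and> y = A"
          using A(3) unfolding doubleton_eq_iff by blast
        moreover have "A - {w} \<subset> A" using A(1) by blast
        ultimately show ?thesis using A(4) by auto
      qed
      show "\<exists>f. embeds f B E \<and> even (card (f r)) = p"
      proof (cases "(r \<in> top) = (q = p)")
        case True
        obtain f where emb: "embeds f B (T q)"
          and "\<forall>u w. {u, w} \<in> edges B \<longrightarrow> (if u \<in> top then f w \<subset> f u else f u \<subset> f w)"
          using N[rule_format, OF n order_trans[OF TE E] q] by (elim exE conjE) (rule that)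
        then have f: "embeds f B (T q)" "if r \<in> top then f s \<subset> f r else f r \<subset> f s"
          using s by simp_all
        have "f ` {r, s} \<in> T q" using f(1) s unfolding embeds_def by blast
        then have "{f r, f s} \<in> T q" by simp
        from parity[OF this] have "even (card (f r)) = p" using f(2) True by (auto split: if_splits)
        moreover have "embeds f B E" using f(1) TE unfolding embeds_def by blast
        ultimately show ?thesis by blast
      next
        case False
        \<comment> \<open>The orientation gives the wrong parity: reflect the cube.\<close>
        define cmp where "cmp = (\<lambda>x. {1..n} - x)"
        have cc: "cmp (cmp x) = x" if "x \<subseteq> {1..n}" for x using that by (auto simp: cmp_def)
        have Tsub: "e \<subseteq> Pow {1..n}" if "e \<in> T q" for e using that by (auto simp: T_def)
        have cce: "cmp ` cmp ` e = e" if "e \<in> T q" for e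
        proof -
          have "cmp ` cmp ` e = (\<lambda>x. cmp (cmp x)) ` e" by (rule image_image)
          also have "\<dots> = (\<lambda>x. x) ` e" by (rule image_cong[OF refl]) (use Tsub[OF that] cc in blast)
          finally show ?thesis by simp
        qed
        define E' where "E' = (`) cmp ` T q"
        have "inj_on ((`) cmp) (T q)" using cce by (rule inj_on_inverseI)
        then have card': "card E' = card (T q)" unfolding E'_def by (rule card_image)
        have E': "E' \<subseteq> edges (hypercube n)"
        proof
          fix e assume "e \<in> E'"
          then obtain A w where A: "w \<in> A" "A \<subseteq> {1..n}" "e = cmp ` {A, A - {w}}"
            unfolding E'_def T_def by blast
          moreover have "cmp (A - {w}) = flip w (cmp A)" using A(1,2) by (auto simp: cmp_def flip_def)
          ultimately have "e = {cmp A, flip w (cmp A)}" by simp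
          moreover have "cmp A \<subseteq> {1..n}" "w \<in> {1..n}" using A(1,2) by (auto simp: cmp_def)
          ultimately show "e \<in> edges (hypercube n)" using hypercube_edge_flipI by metis
        qed
        have "\<gamma> / 2 * real n * 2 ^ n \<le> real (card E')" using q card' by simp
        from N[rule_format, OF n E' this]
        obtain f where emb: "embeds f B E'"
          and "\<forall>u w. {u, w} \<in> edges B \<longrightarrow> (if u \<in> top then f w \<subset> f u else f u \<subset> f w)"
          by (elim exE conjE) (rule that)
        then have f: "embeds f B E'" "if r \<in> top then f s \<subset> f r else f r \<subset> f s"
          using s by simp_all
        define g where "g = (\<lambda>u. cmp (f u))"
        have gT: "g ` e \<in> T q" if "e \<in> edges B" for e
        proof -
          have "f ` e \<in> E'" using f(1) that unfolding embeds_def by blast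
          then obtain e' where "e' \<in> T q" "f ` e = cmp ` e'" unfolding E'_def by blast
          then have "cmp ` f ` e \<in> T q" using cce by metis
          then show ?thesis by (simp add: g_def image_image)
        qed
        have fsub: "f u \<subseteq> {1..n}" if u: "u \<in> verts B" for u
        proof -
          obtain w where "{u, w} \<in> edges B" using iso[OF u] by blast
          then have "f ` {u, w} \<in> E'" using f(1) unfolding embeds_def by blast
          then obtain e where "f ` {u, w} = cmp ` e" unfolding E'_def by blast
          then have "f u \<in> cmp ` e" by blast
          then show ?thesis by (auto simp: cmp_def)
        qed
        have "inj_on g (verts B)"
        proof (rule inj_onI)
          fix u w assume "u \<in> verts B" "w \<in> verts B" "g u = g w"
          moreover from this have "f u = f w" using fsub cc by (metis g_def)
          ultimately show "u = w" using f(1) unfolding embeds_def inj_on_def by blast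
        qed
        then have emb: "embeds g B E" using gT TE unfolding embeds_def by blast
        have sub: "if r \<in> top then g r \<subseteq> g s else g s \<subseteq> g r" using f(2) by (auto simp: g_def cmp_def split: if_splits)
        have "{g r, g s} \<in> T q" using gT[OF s] by simp
        from parity[OF this] have "even (card (g r)) = p" using sub False by (auto split: if_splits)
        then show ?thesis using emb by blast
      qed
    qed
  qed
qed

section \<open>Gluing at a cut vertex\<close>

text \<open>Each edge has exactly one end of parity \<open>p\<close>. So a set of edges is described by the directions
  in which it leaves the vertices of this parity.\<close>

definition flip_edges :: "nat \<Rightarrow> bool \<Rightarrow> (nat set \<Rightarrow> nat set) \<Rightarrow> nat set set set" where
  "flip_edges n p M = {{x, flip d x} | x d. x \<subseteq> {1..n} \<and> even (card x) = p \<and> d \<in> M x}"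

text \<open>The edges at the vertices of parity \<open>p\<close> that are not the root of a copy form a graph without
  a copy rooted in parity \<open>p\<close>: the root of such a copy would have an edge in this graph, hence would
  be one of the excluded vertices. So there are fewer than \<open>K\<close> of these edges.\<close>

lemma few_directions_at_nonroots:
  fixes H :: "'a ugraph"
  assumes forced: "\<And>E. \<lbrakk>E \<subseteq> edges (hypercube n); K \<le> real (card E)\<rbrakk>
      \<Longrightarrow> \<exists>f. embeds f H E \<and> even (card (f v)) = p"
    and u: "{v, u} \<in> edges H" and M: "\<And>x. M x \<subseteq> {1..n}"
  shows "(\<Sum>x | x \<subseteq> {1..n} \<and> even (card x) = p \<and> (\<nexists>f. embeds f H (flip_edges n p M) \<and> f v = x).
            real (card (M x))) < K"
proof (rule ccontr)
  define X where "X = {x. x \<subseteq> {1..n} \<and> even (card x) = p \<and> (\<nexists>f. embeds f H (flip_edges n p M) \<and> f v = x)}"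
  assume "\<not> ?thesis"
  then have large: "K \<le> (\<Sum>x\<in>X. real (card (M x)))" by (simp add: X_def)
  define E where "E = (\<lambda>(x, d). {x, flip d x}) ` Sigma X M"
  have fin: "finite x" if "x \<subseteq> {1..n}" for x :: "nat set" using that finite_subset by blast
  have finX: "finite X" by (rule finite_subset[of _ "Pow {1..n}"]) (auto simp: X_def)
  have par: "even (card (flip d x)) \<noteq> p" if "x \<in> X" for x d
    using that even_card_flip[OF fin] by (auto simp: X_def)
  have "inj_on (\<lambda>(x, d). {x, flip d x}) (Sigma X M)"
  proof (rule inj_onI, clarify)
    fix x d y d' assume x: "x \<in> X" "y \<in> X" "{x, flip d x} = {y, flip d' y}"
    then have "x \<noteq> flip d' y" using par by (auto simp: X_def)
    then have "x = y" "flip d x = flip d' y" using x(3) unfolding doubleton_eq_iff by blast+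
    then show "x = y \<and> d = d'" by (simp add: flip_inject)
  qed
  then have "card E = card (Sigma X M)" unfolding E_def by (rule card_image)
  also have "\<dots> = (\<Sum>x\<in>X. card (M x))" using finX fin[OF M] by (intro card_SigmaI) auto
  finally have "K \<le> real (card E)" using large by simp
  moreover have "E \<subseteq> edges (hypercube n)"
  proof
    fix e assume "e \<in> E"
    then obtain x d where "x \<in> X" "d \<in> M x" "e = {x, flip d x}" by (auto simp: E_def)
    moreover from this have "x \<subseteq> {1..n}" "d \<in> {1..n}" using M[of x] by (auto simp: X_def)
    ultimately show "e \<in> edges (hypercube n)" using hypercube_edge_flipI by simp
  qed
  ultimately obtain f where f: "embeds f H E" "even (card (f v)) = p" using forced by blast
  have "f ` {v, u} \<in> E" using f(1) u unfolding embeds_def by blast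
  then obtain x d where x: "x \<in> X" "{f v, f u} = {x, flip d x}" by (auto simp: E_def)
  moreover have "f v \<noteq> flip d x" using par[OF x(1), of d] f(2) by metis
  ultimately have "f v = x" unfolding doubleton_eq_iff by blast
  moreover have "E \<subseteq> flip_edges n p M" by (auto simp: E_def flip_edges_def X_def)
  then have "embeds f H (flip_edges n p M)" using f(1) unfolding embeds_def by blast
  ultimately show False using x(1) by (auto simp: X_def)
qed

lemma embedding_stays_in_subcube:
  assumes "reachable H v u" "embeds f H (flip_edges n p M)" and M: "\<And>x. M x \<subseteq> D"
  shows "f u - D = f v - D"
  using assms(1) unfolding reachable_def
proof (induction rule: rtrancl_induct)
  case (step a b)
  then have "f ` {a, b} \<in> flip_edges n p M" using assms(2) unfolding embeds_def by blast
  then obtain x d where xd: "{f a, f b} = {x, flip d x}" "d \<in> M x" unfolding flip_edges_def by auto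
  have "d \<in> D" using M xd(2) by blast
  then have "flip d x - D = x - D" by (auto simp: flip_def)
  with xd(1) have "f a - D = f b - D" unfolding doubleton_eq_iff by metis
  with step show ?case by simp
qed simp

lemma card_separating_sets:
  assumes V: "finite V" and ab: "a \<in> V" "b \<in> V" "a \<noteq> b"
  shows "4 * card {D\<in>Pow V. a \<in> D \<and> b \<notin> D} = 2 ^ card V"
proof -
  have eq: "{D\<in>Pow V. a \<in> D \<and> b \<notin> D} = insert a ` Pow (V - {a, b})"
  proof
    show "{D\<in>Pow V. a \<in> D \<and> b \<notin> D} \<subseteq> insert a ` Pow (V - {a, b})"
    proof clarify
      fix D assume "D \<subseteq> V" "a \<in> D" "b \<notin> D"
      then show "D \<in> insert a ` Pow (V - {a, b})"
        by (intro image_eqI[of _ _ "D - {a}"]) auto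
    qed
  qed (use ab in auto)
  have "inj_on (insert a) (Pow (V - {a, b}))"
    by (rule inj_on_inverseI[of _ "\<lambda>D. D - {a}"]) auto
  then have "card {D\<in>Pow V. a \<in> D \<and> b \<notin> D} = 2 ^ card (V - {a, b})"
    unfolding eq using V by (simp add: card_image card_Pow)
  moreover have "card (V - {a, b}) = card V - 2" using V ab by (simp add: card_Diff_subset)
  moreover have "card V \<ge> 2" using card_mono[OF V, of "{a, b}"] ab by simp
  then obtain m where "card V = m + 2" by (metis le_add_diff_inverse2)
  ultimately show ?thesis by simp
qed

text \<open>A random set \<open>D\<close> puts the first of two given distinct elements inside and the second outside
  with probability one quarter.\<close>

lemma ex_balanced_split:
  fixes N :: "'u \<Rightarrow> 'v set"
  assumes U: "finite U" and V: "finite V" and N: "\<And>x. x \<in> U \<Longrightarrow> N x \<subseteq> V"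
  shows "\<exists>D\<subseteq>V. (\<Sum>x\<in>U. real (card (distinct_lists 2 (N x))))
           \<le> 4 * (\<Sum>x\<in>U. real (card (N x \<inter> D)) * real (card (N x - D)))"
proof -
  have finN: "finite (N x)" if "x \<in> U" for x using N[OF that] V finite_subset by blast
  have per: "real (card (distinct_lists 2 (N x))) * 2 ^ card V
      = 4 * (\<Sum>D\<in>Pow V. real (card (N x \<inter> D)) * real (card (N x - D)))" if x: "x \<in> U" for x
  proof -
    let ?P = "{(a, b). a \<in> N x \<and> b \<in> N x \<and> a \<noteq> b}"
    have "bij_betw (\<lambda>(a, b). [a, b]) ?P (distinct_lists 2 (N x))"
      by (rule bij_betw_byWitness[where f' = "\<lambda>zs. (zs ! 0, zs ! 1)"])
        (auto simp: distinct_lists_def numeral_2_eq_2 length_Suc_conv)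
    then have cP: "card (distinct_lists 2 (N x)) = card ?P" by (simp add: bij_betw_same_card)
    have finP: "finite ?P" by (rule finite_subset[of _ "N x \<times> N x"]) (use finN[OF x] in auto)
    have "4 * card (Sigma (Pow V) (\<lambda>D. (N x \<inter> D) \<times> (N x - D)))
        = 4 * card (Sigma ?P (\<lambda>(a, b). {D\<in>Pow V. a \<in> D \<and> b \<notin> D}))"
      by (subst bij_betw_same_card[of prod.swap "Sigma ?P (\<lambda>(a, b). {D\<in>Pow V. a \<in> D \<and> b \<notin> D})"])
        (auto simp: bij_betw_def inj_on_def image_def)
    also have "\<dots> = (\<Sum>(a, b)\<in>?P. 4 * card {D\<in>Pow V. a \<in> D \<and> b \<notin> D})"
      using finP V by (subst card_SigmaI) (auto simp: sum_distrib_left case_prod_beta)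
    also have "\<dots> = (\<Sum>(a, b)\<in>?P. 2 ^ card V)"
    proof (rule sum.cong)
      fix q assume "q \<in> ?P"
      then show "(case q of (a, b) \<Rightarrow> 4 * card {D\<in>Pow V. a \<in> D \<and> b \<notin> D}) = (case q of (a, b) \<Rightarrow> 2 ^ card V)"
        using N[OF x] card_separating_sets[OF V, of "fst q" "snd q"] by (auto simp: case_prod_beta)
    qed simp
    also have "\<dots> = card ?P * 2 ^ card V" by (simp add: case_prod_beta)
    finally have "card ?P * 2 ^ card V = 4 * (\<Sum>D\<in>Pow V. card (N x \<inter> D) * card (N x - D))"
      using finN[OF x] V by (simp add: card_SigmaI card_cartesian_product)
    then have "real (card ?P * 2 ^ card V) = real (4 * (\<Sum>D\<in>Pow V. card (N x \<inter> D) * card (N x - D)))" by metis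
    then show ?thesis unfolding cP by simp
  qed
  have "(\<Sum>x\<in>U. real (card (distinct_lists 2 (N x)))) * real (card (Pow V))
      = (\<Sum>x\<in>U. 4 * (\<Sum>D\<in>Pow V. real (card (N x \<inter> D)) * real (card (N x - D))))"
    using per V by (simp add: sum_distrib_right card_Pow)
  also have "\<dots> = (\<Sum>D\<in>Pow V. 4 * (\<Sum>x\<in>U. real (card (N x \<inter> D)) * real (card (N x - D))))"
    by (simp add: sum_distrib_left) (rule sum.swap)
  finally show ?thesis
    using ex_ge_average[of "Pow V" "\<Sum>x\<in>U. real (card (distinct_lists 2 (N x)))"] V by auto
qed

text \<open>Split the directions of the cube into \<open>D\<close> and its complement, and look for \<open>H1\<close> along the
  directions in \<open>D\<close> and for \<open>H2\<close> along the others. Two such copies with common root \<open>x\<close> have no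
  other common vertex, since one agrees with \<open>x\<close> outside \<open>D\<close> and the other one inside \<open>D\<close>. For a
  suitable \<open>D\<close>, the sum over \<open>x\<close> of the product of the two degrees is of the order of
  \<open>n\<^sup>2 2\<^sup>n\<close>. The vertices that are not roots of a copy of \<open>H1\<close>, or not of a copy of \<open>H2\<close>,
  contribute little to this sum, so some vertex is a root for both.\<close>

lemma unavoidable_at_glue:
  fixes H H1 H2 :: "'a ugraph"
  assumes verts: "verts H = verts H1 \<union> verts H2" "verts H1 \<inter> verts H2 = {v}"
    and edges: "edges H = edges H1 \<union> edges H2"
    and simple: "simple_graph H1" "simple_graph H2"
    and conn: "connected_graph H1" "connected_graph H2"
    and nontriv: "{v, u1} \<in> edges H1" "{v, u2} \<in> edges H2"
    and un: "unavoidable_at H1 v" "unavoidable_at H2 v"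
  shows "unavoidable_at H v"
  unfolding unavoidable_at_def
proof (intro allI impI)
  fix p and \<gamma> :: real assume \<gamma>: "\<gamma> > 0"
  define \<kappa> where "\<kappa> = \<gamma> / 2 * (\<gamma> / 4) ^ 2"
  \<comment> \<open>The split loses a factor 4, and each of the two kinds of exceptional vertices may use up at most
    a quarter of what remains.\<close>
  define \<epsilon> where "\<epsilon> = \<kappa> / 16"
  have pos: "\<kappa> > 0" "\<epsilon> > 0" using \<gamma> by (auto simp: \<kappa>_def \<epsilon>_def)
  obtain N1 where N1: "\<forall>n\<ge>N1. \<forall>E\<subseteq>edges (hypercube n).
      \<epsilon> * real n * 2 ^ n \<le> real (card E) \<longrightarrow> (\<exists>f. embeds f H1 E \<and> even (card (f v)) = p)"
    using un(1) pos unfolding unavoidable_at_def by blast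
  obtain N2 where N2: "\<forall>n\<ge>N2. \<forall>E\<subseteq>edges (hypercube n).
      \<epsilon> * real n * 2 ^ n \<le> real (card E) \<longrightarrow> (\<exists>f. embeds f H2 E \<and> even (card (f v)) = p)"
    using un(2) pos unfolding unavoidable_at_def by blast
  define N where "N = Suc (max (max N1 N2) (nat \<lceil>8 / \<gamma>\<rceil>))"
  show "\<exists>N. \<forall>n\<ge>N. \<forall>E\<subseteq>edges (hypercube n).
      \<gamma> * real n * 2 ^ n \<le> real (card E) \<longrightarrow> (\<exists>f. embeds f H E \<and> even (card (f v)) = p)"
  proof (intro exI[of _ N] allI impI)
    fix n E assume n: "n \<ge> N" and E: "E \<subseteq> edges (hypercube n)"
      and dense: "\<gamma> * real n * 2 ^ n \<le> real (card E)"
    have n12: "n \<ge> N1" "n \<ge> N2" "n > 0" using n by (auto simp: N_def)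
    have "8 / \<gamma> \<le> real n" using n unfolding N_def by linarith
    then have large: "4 * real 2 \<le> \<gamma> * real (card {1..n})" using \<gamma> by (simp add: field_simps)
    define U where "U = {x. x \<subseteq> {1..n} \<and> even (card x) = p}"
    define M where "M = (\<lambda>x. {d\<in>{1..n}. x \<in> U \<and> {x, flip d x} \<in> E})"
    have M: "M x \<subseteq> {1..n}" for x by (auto simp: M_def)
    have finM: "finite (M x)" for x using M finite_subset by blast
    have finU: "finite U" by (rule finite_subset[of _ "Pow {1..n}"]) (auto simp: U_def)
    have "E \<subseteq> (\<lambda>(x, d). {x, flip d x}) ` Sigma (Pow {1..n}) M"
    proof
      fix e assume e: "e \<in> E"
      then have "e \<in> edges (hypercube n)" using E by blast
      then obtain x d where x: "x \<subseteq> {1..n}" "d \<in> {1..n}" "e = {x, flip d x}" "even (card x) = p"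
        by (rule hypercube_edge_at_parity)
      then have "(x, d) \<in> Sigma (Pow {1..n}) M" using e by (simp add: M_def U_def)
      then show "e \<in> (\<lambda>(x, d). {x, flip d x}) ` Sigma (Pow {1..n}) M" using x(3) by (force intro: rev_image_eqI)
    qed
    moreover have "finite (Sigma (Pow {1..n}) M)" using finM by (intro finite_SigmaI) auto
    ultimately have "card E \<le> card (Sigma (Pow {1..n}) M)"
      by (meson card_mono card_image_le finite_imageI le_trans)
    also have "\<dots> = (\<Sum>x\<in>Pow {1..n}. card (M x))" using finM by (intro card_SigmaI) auto
    finally have "real (card E) \<le> real (\<Sum>x\<in>Pow {1..n}. card (M x))" by (rule of_nat_mono)
    then have "\<gamma> * real (card (Pow {1..n})) * real (card {1..n}) \<le> (\<Sum>x\<in>Pow {1..n}. real (card (M x)))"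
      using dense by (simp add: card_Pow algebra_simps)
    from many_distinct_lists[OF _ _ _ M \<gamma> this large]
    have many: "\<kappa> * 2 ^ n * real n ^ 2 \<le> (\<Sum>x\<in>Pow {1..n}. real (card (distinct_lists 2 (M x))))"
      using n12 by (simp add: \<kappa>_def card_Pow)
    obtain D where D: "(\<Sum>x\<in>Pow {1..n}. real (card (distinct_lists 2 (M x))))
           \<le> 4 * (\<Sum>x\<in>Pow {1..n}. real (card (M x \<inter> D)) * real (card (M x - D)))"
      using ex_balanced_split[of "Pow {1..n}" "{1..n}" M] M by auto
    define R1 where "R1 = {x\<in>U. \<exists>f. embeds f H1 (flip_edges n p (\<lambda>x. M x \<inter> D)) \<and> f v = x}"
    define R2 where "R2 = {x\<in>U. \<exists>f. embeds f H2 (flip_edges n p (\<lambda>x. M x - D)) \<and> f v = x}"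
    have "(\<Sum>x\<in>U - R1. real (card (M x \<inter> D))) < \<epsilon> * real n * 2 ^ n"
    proof -
      have "U - R1 = {x. x \<subseteq> {1..n} \<and> even (card x) = p \<and> (\<nexists>f. embeds f H1 (flip_edges n p (\<lambda>x. M x \<inter> D)) \<and> f v = x)}"
        by (auto simp: R1_def U_def)
      moreover have "M x \<inter> D \<subseteq> {1..n}" for x using M by blast
      ultimately show ?thesis
        using few_directions_at_nonroots[of n "\<epsilon> * real n * 2 ^ n" H1 v p u1 "\<lambda>x. M x \<inter> D"] N1 n12 nontriv by simp
    qed
    moreover have "(\<Sum>x\<in>U - R2. real (card (M x - D))) < \<epsilon> * real n * 2 ^ n"
    proof -
      have "U - R2 = {x. x \<subseteq> {1..n} \<and> even (card x) = p \<and> (\<nexists>f. embeds f H2 (flip_edges n p (\<lambda>x. M x - D)) \<and> f v = x)}"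
        by (auto simp: R2_def U_def)
      moreover have "M x - D \<subseteq> {1..n}" for x using M by blast
      ultimately show ?thesis
        using few_directions_at_nonroots[of n "\<epsilon> * real n * 2 ^ n" H2 v p u2 "\<lambda>x. M x - D"] N2 n12 nontriv by simp
    qed
    ultimately have few: "(\<Sum>x\<in>U - R1. real (card (M x \<inter> D))) * real n + (\<Sum>x\<in>U - R2. real (card (M x - D))) * real n
        < (\<epsilon> * real n * 2 ^ n) * real n + (\<epsilon> * real n * 2 ^ n) * real n"
      using n12(3) by (intro add_strict_mono mult_strict_right_mono) auto
    have le_n: "real (card (M x \<inter> D)) \<le> real n" "real (card (M x - D)) \<le> real n" for x
      using card_mono[of "{1..n}" "M x \<inter> D"] card_mono[of "{1..n}" "M x - D"] M by auto
    have "R1 \<inter> R2 \<noteq> {}"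
    proof
      assume disj: "R1 \<inter> R2 = {}"
      have "(\<Sum>x\<in>Pow {1..n}. real (card (M x \<inter> D)) * real (card (M x - D)))
          = (\<Sum>x\<in>U. real (card (M x \<inter> D)) * real (card (M x - D)))"
        by (rule sum.mono_neutral_right) (auto simp: U_def M_def)
      also have "U = (U - R1) \<union> (U - R2)" using disj by blast
      also have "(\<Sum>x\<in>(U - R1) \<union> (U - R2). real (card (M x \<inter> D)) * real (card (M x - D)))
          \<le> (\<Sum>x\<in>U - R1. real (card (M x \<inter> D)) * real (card (M x - D)))
            + (\<Sum>x\<in>U - R2. real (card (M x \<inter> D)) * real (card (M x - D)))"
        using finU by (subst sum.union_inter[symmetric]) (auto intro!: sum_nonneg)
      also have "\<dots> \<le> (\<Sum>x\<in>U - R1. real (card (M x \<inter> D)) * real n)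
            + (\<Sum>x\<in>U - R2. real (card (M x - D)) * real n)"
      proof (intro add_mono sum_mono)
        fix x
        show "real (card (M x \<inter> D)) * real (card (M x - D)) \<le> real (card (M x \<inter> D)) * real n"
          using le_n by (intro mult_left_mono) auto
        show "real (card (M x \<inter> D)) * real (card (M x - D)) \<le> real (card (M x - D)) * real n"
          using le_n(1)[of x] by (subst mult.commute) (intro mult_left_mono, auto)
      qed
      also have "\<dots> < (\<epsilon> * real n * 2 ^ n) * real n + (\<epsilon> * real n * 2 ^ n) * real n"
        using few by (simp add: sum_distrib_right)
      finally have "4 * (\<Sum>x\<in>Pow {1..n}. real (card (M x \<inter> D)) * real (card (M x - D)))
          < \<kappa> / 2 * 2 ^ n * real n ^ 2"
        by (simp add: \<epsilon>_def power2_eq_square algebra_simps)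
      then have "\<kappa> * 2 ^ n * real n ^ 2 < \<kappa> / 2 * 2 ^ n * real n ^ 2" using many D by linarith
      then show False using pos n12 by (simp add: mult_less_cancel_right)
    qed
    then obtain x f1 f2 where f1: "embeds f1 H1 (flip_edges n p (\<lambda>x. M x \<inter> D))" "f1 v = x"
      and f2: "embeds f2 H2 (flip_edges n p (\<lambda>x. M x - D))" "f2 v = x" and x: "x \<in> U"
      unfolding R1_def R2_def by blast
    have v: "v \<in> verts H1" "v \<in> verts H2" using verts(2) by auto
    have meet: "a = v \<and> b = v" if ab: "a \<in> verts H1" "b \<in> verts H2" "f1 a = f2 b" for a b
    proof -
      have "f1 a - D = x - D"
        using embedding_stays_in_subcube[OF _ f1(1), of v a D] conn(1) v ab f1(2)
        unfolding connected_graph_def by auto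
      moreover have "f2 b - (- D) = x - (- D)"
        using embedding_stays_in_subcube[OF _ f2(1), of v b "- D"] conn(2) v ab f2(2)
        unfolding connected_graph_def by auto
      ultimately have "f1 a = x" using ab(3) by blast
      then show ?thesis
        using f1 f2 ab v unfolding embeds_def by (metis inj_onD)
    qed
    define f where "f = (\<lambda>a. if a \<in> verts H1 then f1 a else f2 a)"
    have f_H2: "f b = f2 b" if "b \<in> verts H2" for b
      using that verts(2) f1(2) f2(2) by (auto simp: f_def)
    have "inj_on f (verts H)"
    proof (rule inj_onI)
      fix a b assume ab: "a \<in> verts H" "b \<in> verts H" "f a = f b"
      have i: "inj_on f1 (verts H1)" "inj_on f2 (verts H2)" using f1 f2 unfolding embeds_def by auto
      show "a = b"
      proof (cases "a \<in> verts H1")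
        case True
        then have a: "f a = f1 a" by (simp add: f_def)
        show ?thesis
        proof (cases "b \<in> verts H1")
          case True then show ?thesis using a ab(3) \<open>a \<in> verts H1\<close> i(1) by (auto simp: f_def inj_on_def)
        next
          case False
          then have "b \<in> verts H2" using ab verts by blast
          then show ?thesis using meet[OF \<open>a \<in> verts H1\<close>, of b] a ab(3) f_H2 by auto
        qed
      next
        case False
        then have a: "a \<in> verts H2" using ab verts by blast
        show ?thesis
        proof (cases "b \<in> verts H1")
          case True then show ?thesis using meet[OF True a] ab(3) f_H2[OF a] by (auto simp: f_def)
        next
          case False
          then have "b \<in> verts H2" using ab verts by blast
          then show ?thesis using a ab(3) f_H2 i(2) by (auto simp: inj_on_def)
        qed
      qed
    qed
    moreover have "f ` e \<in> E" if "e \<in> edges H" for e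
    proof (cases "e \<in> edges H1")
      case True
      then have "e \<subseteq> verts H1" using simple unfolding simple_graph_def by blast
      then have "f ` e = f1 ` e" by (force simp: f_def)
      moreover have "f1 ` e \<in> flip_edges n p (\<lambda>x. M x \<inter> D)" using f1 True unfolding embeds_def by blast
      ultimately show ?thesis by (auto simp: flip_edges_def M_def)
    next
      case False
      then have e2: "e \<in> edges H2" using that edges by blast
      then have "e \<subseteq> verts H2" using simple unfolding simple_graph_def by blast
      then have "f ` e = f2 ` e" using f_H2 by (auto simp: subset_iff image_iff)
      moreover have "f2 ` e \<in> flip_edges n p (\<lambda>x. M x - D)" using f2 e2 unfolding embeds_def by blast
      ultimately show ?thesis by (auto simp: flip_edges_def M_def)
    qed
    moreover have "even (card (f v)) = p" using x v f1(2) by (simp add: f_def U_def)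
    ultimately show "\<exists>f. embeds f H E \<and> even (card (f v)) = p" unfolding embeds_def by blast
  qed
qed

lemma reachable_parity:
  assumes "reachable H v u"
  shows "\<exists>q. \<forall>f n E. embeds f H E \<longrightarrow> E \<subseteq> edges (hypercube n) \<longrightarrow>
           even (card (f u)) = (even (card (f v)) = q)"
  using assms unfolding reachable_def
proof (induction rule: rtrancl_induct)
  case base
  show ?case by (rule exI[of _ True]) simp
next
  case (step a b)
  then obtain q where q: "\<forall>f n E. embeds f H E \<longrightarrow> E \<subseteq> edges (hypercube n) \<longrightarrow>
           even (card (f a)) = (even (card (f v)) = q)" by (elim exE)
  have "even (card (f b)) = (even (card (f v)) = (\<not> q))"
    if f: "embeds f H E" and E: "E \<subseteq> edges (hypercube n)" for f n E
  proof -
    have "f ` {a, b} \<in> E" using f step(2) unfolding embeds_def by blast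
    then have "{f a, f b} \<in> edges (hypercube n)" using E by auto
    then obtain x d where x: "x \<subseteq> {1..n}" "d \<in> {1..n}" "{f a, f b} = {x, flip d x}" "even (card x) = True"
      by (rule hypercube_edge_at_parity)
    have "finite x" using x(1) finite_subset by blast
    then have "odd (card (flip d x))" using x(4) even_card_flip by blast
    then have "even (card (f b)) \<noteq> even (card (f a))"
      using x(3,4) unfolding doubleton_eq_iff by metis
    then show ?thesis using q[rule_format, OF f E] by blast
  qed
  then show ?case by (intro exI[of _ "\<not> q"] allI impI)
qed

text \<open>Adjacent vertices of the cube have different parity, so in a connected graph the parity of one
  image determines the parity of all others.\<close>

lemma unavoidable_at_other_root:
  assumes "unavoidable_at H v" "reachable H v r"
  shows "unavoidable_at H r"
proof -
  obtain q where q: "\<forall>f n E. embeds f H E \<longrightarrow> E \<subseteq> edges (hypercube n) \<longrightarrow>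
           even (card (f r)) = (even (card (f v)) = q)"
    using reachable_parity[OF assms(2)] by (elim exE)
  show ?thesis
    unfolding unavoidable_at_def
  proof (intro allI impI)
    fix p and \<gamma> :: real assume "\<gamma> > 0"
    then obtain N where N: "\<forall>n\<ge>N. \<forall>E\<subseteq>edges (hypercube n). \<gamma> * real n * 2 ^ n \<le> real (card E) \<longrightarrow>
        (\<exists>f. embeds f H E \<and> even (card (f v)) = (p = q))"
      using assms(1) unfolding unavoidable_at_def by blast
    show "\<exists>N. \<forall>n\<ge>N. \<forall>E\<subseteq>edges (hypercube n). \<gamma> * real n * 2 ^ n \<le> real (card E) \<longrightarrow>
        (\<exists>f. embeds f H E \<and> even (card (f r)) = p)"
    proof (intro exI[of _ N] allI impI)
      fix n E assume E: "n \<ge> N" "E \<subseteq> edges (hypercube n)" "\<gamma> * real n * 2 ^ n \<le> real (card E)"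
      then obtain f where f: "embeds f H E" "even (card (f v)) = (p = q)" using N by blast
      then have "even (card (f r)) = p" using q[rule_format, OF f(1) E(2)] by blast
      then show "\<exists>f. embeds f H E \<and> even (card (f r)) = p" using f(1) by blast
    qed
  qed
qed

section \<open>Decomposition into blocks\<close>

text \<open>The two parts may also be disjoint, so that separating a connected component is covered. Then
  \<open>v\<close> is arbitrary.\<close>

definition glued :: "'a ugraph \<Rightarrow> 'a ugraph \<Rightarrow> 'a ugraph \<Rightarrow> 'a \<Rightarrow> bool" where
  "glued H H1 H2 v \<longleftrightarrow> simple_graph H1 \<and> simple_graph H2 \<and> verts H = verts H1 \<union> verts H2 \<and>
     edges H = edges H1 \<union> edges H2 \<and> verts H1 \<inter> verts H2 \<subseteq> {v}"

lemma simple_graph_edge_verts: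
  assumes "simple_graph G" "{a, b} \<in> edges G"
  shows "a \<in> verts G" "b \<in> verts G"
proof -
  have "{a, b} \<subseteq> verts G" using assms unfolding simple_graph_def by metis
  then show "a \<in> verts G" "b \<in> verts G" by simp_all
qed

lemma glued_sym: "glued H H1 H2 v \<Longrightarrow> glued H H2 H1 v"
  unfolding glued_def by blast

lemma glued_delete_edge:
  "glued H H1 H2 v \<Longrightarrow> glued (delete_edge H e) (delete_edge H1 e) (delete_edge H2 e) v"
  unfolding glued_def delete_edge_def simple_graph_def by auto

text \<open>Contracting \<open>H2\<close> to \<open>v\<close> turns a walk of \<open>H\<close> into a walk of \<open>H1\<close>.\<close>

lemma glued_reachable:
  assumes gl: "glued H H1 H2 v" and reach: "reachable H x y" and xy: "x \<in> verts H1" "y \<in> verts H1"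
  shows "reachable H1 x y"
proof -
  have simple: "simple_graph H1" "simple_graph H2" using gl by (auto simp: glued_def)
  define \<rho> where "\<rho> = (\<lambda>z. if z \<in> verts H1 then z else v)"
  have "reachable H1 (\<rho> x) (\<rho> y)"
    using reach unfolding reachable_def
  proof (induction rule: rtrancl_induct)
    case (step a b)
    have "{a, b} \<in> edges H1 \<or> {a, b} \<in> edges H2" using step(2) gl unfolding glued_def by blast
    then show ?case
    proof
      assume e: "{a, b} \<in> edges H1"
      then have "a \<in> verts H1" "b \<in> verts H1" using simple simple_graph_edge_verts by metis+
      then show ?thesis using step(3) e by (simp add: \<rho>_def rtrancl_into_rtrancl)
    next
      assume e: "{a, b} \<in> edges H2"
      then have "a \<in> verts H2" "b \<in> verts H2" using simple simple_graph_edge_verts by metis+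
      then have "\<rho> a = v" "\<rho> b = v" using gl unfolding glued_def \<rho>_def by auto
      then show ?thesis using step(3) by simp
    qed
  qed simp
  then show ?thesis using xy by (simp add: \<rho>_def)
qed

lemma glued_is_bridge:
  assumes gl: "glued H H1 H2 v" and br: "is_bridge H1 e"
  shows "is_bridge H e"
proof -
  obtain x y where xy: "e = {x, y}" "\<not> reachable (delete_edge H1 e) x y" "e \<in> edges H1"
    using br unfolding is_bridge_def by blast
  have "simple_graph H1" using gl by (simp add: glued_def)
  then have "x \<in> verts (delete_edge H1 e)" "y \<in> verts (delete_edge H1 e)"
    using simple_graph_edge_verts[of H1 x y] xy(1,3) by (simp_all add: delete_edge_def)
  with xy(2) have "\<not> reachable (delete_edge H e) x y"
    using glued_reachable[OF glued_delete_edge[OF gl]] by blast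
  moreover have "e \<in> edges H" using xy(3) gl by (simp add: glued_def)
  ultimately show ?thesis using xy(1) unfolding is_bridge_def by blast
qed

text \<open>A two-connected graph stays connected when \<open>v\<close> is removed, so it cannot have vertices on both
  sides of \<open>v\<close>. One of the vertices of \<open>B\<close> other than \<open>v\<close> tells that its side is \<open>H1\<close>.\<close>

lemma glued_two_connected:
  assumes gl: "glued H H1 H2 v" and B': "subgraph B' H" "two_connected B'"
    and B: "verts B \<subseteq> verts H1" "card (verts B) \<ge> 3" "verts B \<subseteq> verts B'"
  shows "subgraph B' H1"
proof -
  have simple: "simple_graph H1" "simple_graph H2" using gl by (auto simp: glued_def)
  have meet: "x = v" if "x \<in> verts H1" "x \<in> verts H2" for x using gl that by (auto simp: glued_def)
  have edgesH: "edges H = edges H1 \<union> edges H2" using gl by (simp add: glued_def)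
  have simp': "finite (verts B')" "\<And>e. e \<in> edges B' \<Longrightarrow> e \<subseteq> verts B' \<and> card e = 2" "edges B' \<subseteq> edges H"
      "verts B' \<subseteq> verts H"
    using B'(1) unfolding subgraph_def simple_graph_def by auto
  have "\<not> verts B \<subseteq> {v}" using B(2) card_mono[of "{v}" "verts B"] by auto
  then obtain b where b: "b \<in> verts B" "b \<noteq> v" by blast
  have conn: "connected_graph (delete_vertex B' v)"
  proof (cases "v \<in> verts B'")
    case True then show ?thesis using B'(2) unfolding two_connected_def by blast
  next
    case False
    have "verts (delete_vertex B' v) = verts B'" "edges (delete_vertex B' v) = edges B'"
      using False simp'(2) unfolding delete_vertex_def induced_subgraph_def by auto
    then have "delete_vertex B' v = B'" by (intro ugraph.expand) simp
    then show ?thesis using B'(2) unfolding two_connected_def by simp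
  qed
  have stay: "x \<in> verts H1" if "reachable (delete_vertex B' v) b x" for x
    using that unfolding reachable_def
  proof (induction rule: rtrancl_induct)
    case base then show ?case using b B by blast
  next
    case (step y z)
    have yz: "{y, z} \<in> edges B'" "y \<noteq> v"
      using step(2) unfolding delete_vertex_def induced_subgraph_def by auto
    then have "{y, z} \<in> edges H1 \<or> {y, z} \<in> edges H2" using simp'(3) edgesH by blast
    then show ?case
    proof
      assume "{y, z} \<in> edges H2"
      then have "y \<in> verts H2" using simple simple_graph_edge_verts by metis
      then have "y = v" using step(3) meet by blast
      then show ?thesis using yz(2) by simp
    qed (use simple simple_graph_edge_verts in metis)
  qed
  have H1v: "x \<in> verts H1 \<or> x = v" if "x \<in> verts B'" for x
  proof (cases "x = v")
    case False
    then have "x \<in> verts (delete_vertex B' v)" "b \<in> verts (delete_vertex B' v)"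
      using that b B unfolding delete_vertex_def induced_subgraph_def by auto
    then show ?thesis using conn stay unfolding connected_graph_def by blast
  qed simp
  have edges: "e \<in> edges H1" if e: "e \<in> edges B'" for e
  proof (rule ccontr)
    assume "e \<notin> edges H1"
    then have "e \<in> edges H2" using e simp'(3) edgesH by blast
    then have "e \<subseteq> verts H2" using simple(2) by (simp add: simple_graph_def)
    moreover have "e \<subseteq> verts B'" "card e = 2" using simp'(2) e by auto
    ultimately have "e \<subseteq> {v}" using H1v meet by blast
    then have "card e \<le> 1" using card_mono[of "{v}" e] by simp
    then show False using \<open>card e = 2\<close> by simp
  qed
  have "x \<in> verts H1" if x: "x \<in> verts B'" for x
  proof -
    have "connected_graph B'" "b \<in> verts B'" using B'(2) b B unfolding two_connected_def by auto
    then have "reachable B' b x" using x unfolding connected_graph_def by blast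
    then have "(b, x) \<in> {(x, y). {x, y} \<in> edges B'}\<^sup>*" unfolding reachable_def .
    then show ?thesis
    proof (cases rule: rtranclE)
      case base then show ?thesis using b B by blast
    next
      case (step y)
      then have "{y, x} \<in> edges H1" using edges by blast
      then show ?thesis using simple simple_graph_edge_verts by metis
    qed
  qed
  then show ?thesis using edges B'(1) unfolding subgraph_def by blast
qed

lemma glued_is_block:
  assumes gl: "glued H H1 H2 v" and B: "is_block B H1"
  shows "is_block B H"
  using B unfolding is_block_def
proof (elim disjE exE conjE)
  assume sub: "subgraph B H1" and two: "two_connected B"
    and max: "\<forall>B'. subgraph B' H1 \<and> two_connected B' \<and> subgraph B B' \<longrightarrow> B' = B"
  have "subgraph B H" using sub gl unfolding subgraph_def glued_def by blast
  moreover have "B' = B" if B': "subgraph B' H" "two_connected B'" "subgraph B B'" for B'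
  proof -
    have "subgraph B' H1"
      using glued_two_connected[OF gl B'(1,2), of B] sub two B'(3)
      unfolding subgraph_def two_connected_def by blast
    then show ?thesis using max B' by blast
  qed
  ultimately show "subgraph B H \<and> two_connected B \<and>
      (\<forall>B'. subgraph B' H \<and> two_connected B' \<and> subgraph B B' \<longrightarrow> B' = B) \<or>
      (\<exists>e. is_bridge H e \<and> B = Graph e {e})"
    using two by blast
next
  fix e assume "is_bridge H1 e" "B = Graph e {e}"
  then show "subgraph B H \<and> two_connected B \<and>
      (\<forall>B'. subgraph B' H \<and> two_connected B' \<and> subgraph B B' \<longrightarrow> B' = B) \<or>
      (\<exists>e. is_bridge H e \<and> B = Graph e {e})"
    using glued_is_bridge[OF gl] by blast
qed

lemma glued_induced:
  assumes H: "simple_graph H" and closed: "\<And>x y. \<lbrakk>{x, y} \<in> edges H; x \<in> C\<rbrakk> \<Longrightarrow> y \<in> insert v C"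
  shows "glued H (induced_subgraph H (insert v C)) (induced_subgraph H (- C)) v"
proof -
  have "e \<subseteq> insert v C \<or> e \<subseteq> - C" if e: "e \<in> edges H" for e
  proof -
    have "card e = 2" using H e unfolding simple_graph_def by blast
    then obtain x y where xy: "e = {x, y}" by (auto simp: card_2_iff)
    then have "{x, y} \<in> edges H" "{y, x} \<in> edges H" using e by (auto simp: insert_commute)
    then show ?thesis using closed[of x y] closed[of y x] xy by blast
  qed
  then show ?thesis using H unfolding glued_def induced_subgraph_def simple_graph_def by auto
qed

lemma connected_no_isolated:
  assumes "connected_graph H" "card (verts H) \<ge> 2" "u \<in> verts H"
  shows "\<exists>w. {u, w} \<in> edges H"
proof -
  have "\<not> verts H \<subseteq> {u}" using assms(2) card_mono[of "{u}" "verts H"] by auto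
  then obtain w where "w \<in> verts H" "w \<noteq> u" by blast
  then have "(u, w) \<in> {(x, y). {x, y} \<in> edges H}\<^sup>*" "u \<noteq> w"
    using assms unfolding connected_graph_def reachable_def by auto
  then show ?thesis by (auto elim: converse_rtranclE)
qed

lemma single_edge_block:
  assumes H: "simple_graph H" and conn: "connected_graph H" and two: "card (verts H) = 2"
  shows "is_block H H"
proof -
  obtain a b where ab: "verts H = {a, b}" "a \<noteq> b" using two by (auto simp: card_2_iff)
  have e: "e = {a, b}" if "e \<in> edges H" for e
    using that H ab two unfolding simple_graph_def by (metis card_subset_eq)
  obtain w where aw: "{a, w} \<in> edges H" using connected_no_isolated[OF conn, of a] ab by auto
  have "{a, b} \<in> edges H" using aw e[OF aw] by simp
  moreover have "edges H \<subseteq> {{a, b}}" by (intro subsetI) (simp add: e)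
  ultimately have E: "edges H = {{a, b}}" by (intro subset_antisym) simp_all
  then have "edges (delete_edge H {a, b}) = {}" by (simp add: delete_edge_def)
  then have "\<not> reachable (delete_edge H {a, b}) a b" using ab(2) by (simp add: reachable_def)
  then have "is_bridge H {a, b}"
    unfolding is_bridge_def using E by (intro conjI exI[of _ a] exI[of _ b]) simp_all
  moreover have "H = Graph {a, b} {{a, b}}" using ab E by (metis ugraph.collapse)
  ultimately show ?thesis unfolding is_block_def by blast
qed

text \<open>Induction on the number of vertices: a connected graph with an edge either is a block or has a
  cut vertex, at which it is glued from two smaller connected graphs whose blocks are blocks of it.\<close>

lemma connected_unavoidable:
  fixes H :: "'a ugraph"
  assumes "simple_graph H" "connected_graph H" "card (verts H) \<ge> 2"
    and "\<And>B. is_block B H \<Longrightarrow> has_partite_representation B" and "r \<in> verts H"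
  shows "unavoidable_at H r"
  using assms
proof (induction "card (verts H)" arbitrary: H r rule: less_induct)
  case less
  note H = less.prems(1) and conn = less.prems(2) and big = less.prems(3)
    and blocks = less.prems(4) and r = less.prems(5)
  have reach: "reachable H x y" if "x \<in> verts H" "y \<in> verts H" for x y
    using conn that unfolding connected_graph_def by blast
  show ?case
  proof (cases "is_block H H")
    case True
    then show ?thesis
      using unavoidable_at_if_partite[OF H blocks] connected_no_isolated[OF conn big] r by blast
  next
    case False
    then have "card (verts H) \<noteq> 2" using single_edge_block[OF H conn] by blast
    then have three: "card (verts H) \<ge> 3" using big by linarith
    have "\<not> two_connected H"
    proof
      assume two: "two_connected H"
      have "B' = H" if "subgraph B' H" "subgraph H B'" for B'
        using that unfolding subgraph_def by (intro ugraph.expand) auto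
      moreover have "subgraph H H" using H unfolding subgraph_def by blast
      ultimately show False using two False unfolding is_block_def by blast
    qed
    then obtain v where v: "v \<in> verts H" and disc: "\<not> connected_graph (delete_vertex H v)"
      using three conn unfolding two_connected_def by blast
    have vD: "verts (delete_vertex H v) = verts H - {v}"
      by (auto simp: delete_vertex_def induced_subgraph_def)
    have finH: "finite (verts H)" using H unfolding simple_graph_def by blast
    have "verts H - {v} \<noteq> {}"
    proof
      assume "verts H - {v} = {}"
      then show False using three card_mono[of "{v}" "verts H"] by auto
    qed
    then obtain u w where uw: "u \<in> verts H - {v}" "w \<in> verts H - {v}" "\<not> reachable (delete_vertex H v) u w"
      using disc unfolding connected_graph_def vD by blast
    define C where "C = {x \<in> verts H - {v}. reachable (delete_vertex H v) u x}"
    define H1 where "H1 = induced_subgraph H (insert v C)"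
    define H2 where "H2 = induced_subgraph H (- C)"
    have closed: "y \<in> insert v C" if xy: "{x, y} \<in> edges H" "x \<in> C" for x y
    proof (cases "y = v")
      case False
      have "x \<noteq> v" "y \<in> verts H" "x \<in> verts H" using xy H unfolding C_def simple_graph_def by auto
      then have "{x, y} \<in> edges (delete_vertex H v)"
        using xy(1) False by (auto simp: delete_vertex_def induced_subgraph_def)
      moreover have "reachable (delete_vertex H v) u x" using xy(2) by (simp add: C_def)
      ultimately have "reachable (delete_vertex H v) u y"
        unfolding reachable_def by (simp add: rtrancl_into_rtrancl)
      then show ?thesis using False \<open>y \<in> verts H\<close> by (simp add: C_def)
    qed simp
    have gl: "glued H H1 H2 v" unfolding H1_def H2_def by (rule glued_induced[OF H]) (rule closed)
    have uC: "u \<in> C" using uw by (simp add: C_def reachable_def)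
    have V1: "verts H1 = insert v C" and V2: "verts H2 = verts H - C"
      using v by (auto simp: H1_def H2_def induced_subgraph_def C_def)
    have simple: "simple_graph H1" "simple_graph H2" using gl unfolding glued_def by auto
    have subs: "verts H1 \<subseteq> verts H" "verts H2 \<subseteq> verts H" using gl by (auto simp: glued_def)
    have conn1: "connected_graph H1"
      unfolding connected_graph_def
    proof (intro conjI ballI)
      fix x y assume "x \<in> verts H1" "y \<in> verts H1"
      then show "reachable H1 x y"
        using glued_reachable[OF gl reach, of x y] subs by blast
    qed (use V1 in simp)
    have vC: "v \<notin> C" by (simp add: C_def)
    have conn2: "connected_graph H2"
      unfolding connected_graph_def
    proof (intro conjI ballI)
      fix x y assume "x \<in> verts H2" "y \<in> verts H2"
      then show "reachable H2 x y"
        using glued_reachable[OF glued_sym[OF gl] reach, of x y] subs by blast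
    qed (use V2 v vC in blast)
    have wC: "w \<notin> C" using uw by (simp add: C_def)
    have sub: "verts H1 \<subset> verts H" "verts H2 \<subset> verts H"
      using V1 V2 uC wC uw v by (auto simp: C_def)
    have less1: "card (verts H1) < card (verts H)" "card (verts H2) < card (verts H)"
      using sub finH by (auto intro: psubset_card_mono)
    have fin: "finite (verts H1)" "finite (verts H2)" using simple by (simp_all add: simple_graph_def)
    have "card {u, v} \<le> card (verts H1)" "card {w, v} \<le> card (verts H2)"
      using card_mono[OF fin(1), of "{u, v}"] card_mono[OF fin(2), of "{w, v}"] V1 V2 uC uw v vC wC by simp_all
    then have two: "card (verts H1) \<ge> 2" "card (verts H2) \<ge> 2" using uw by auto
    have v12: "v \<in> verts H1" "v \<in> verts H2" using V1 V2 v vC by auto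
    have un1: "unavoidable_at H1 v"
      using less.hyps[OF less1(1) simple(1) conn1 two(1) _ v12(1)] blocks glued_is_block[OF gl] by blast
    have un2: "unavoidable_at H2 v"
      using less.hyps[OF less1(2) simple(2) conn2 two(2) _ v12(2)] blocks
        glued_is_block[OF glued_sym[OF gl]] by blast
    have union: "verts H = verts H1 \<union> verts H2" "edges H = edges H1 \<union> edges H2"
      using gl by (simp_all add: glued_def)
    have meet: "verts H1 \<inter> verts H2 = {v}" using gl v12 unfolding glued_def by blast
    obtain u1 where u1: "{v, u1} \<in> edges H1" using connected_no_isolated[OF conn1 two(1) v12(1)] by blast
    obtain u2 where u2: "{v, u2} \<in> edges H2" using connected_no_isolated[OF conn2 two(2) v12(2)] by blast
    have "unavoidable_at H v"
      by (rule unavoidable_at_glue[OF union(1) meet union(2) simple conn1 conn2 u1 u2 un1 un2])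
    then show ?thesis by (rule unavoidable_at_other_root[OF _ reach[OF v r]])
  qed
qed

section \<open>Disconnected graphs and the density statement\<close>

lemma card_edges_touching_le:
  assumes E: "E \<subseteq> edges (hypercube n)" and X: "finite X"
  shows "card {e\<in>E. e \<inter> X \<noteq> {}} \<le> card X * n"
proof -
  have "{e\<in>E. e \<inter> X \<noteq> {}} \<subseteq> (\<lambda>(x, d). {x, flip d x}) ` (X \<times> {1..n})"
  proof
    fix e assume "e \<in> {e\<in>E. e \<inter> X \<noteq> {}}"
    then obtain x where e: "e \<in> E" and x: "x \<in> e" "x \<in> X" by blast
    have "e \<in> edges (hypercube n)" using e E by blast
    then obtain y d where y: "y \<subseteq> {1..n}" "d \<in> {1..n}" "e = {y, flip d y}" "even (card y) = True"
      by (rule hypercube_edge_at_parity)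
    then have "x = y \<or> x = flip d y" using x(1) by simp
    then have "e = {x, flip d x}" using y(3) by (elim disjE) (simp_all add: insert_commute)
    then show "e \<in> (\<lambda>(x, d). {x, flip d x}) ` (X \<times> {1..n})" using x(2) y(2) by (force intro: rev_image_eqI)
  qed
  then have "card {e\<in>E. e \<inter> X \<noteq> {}} \<le> card (X \<times> {1..n})"
    using X by (intro surj_card_le) auto
  then show ?thesis by (simp add: card_cartesian_product)
qed

text \<open>A graph with several components is embedded in two steps. The vertices of a copy of the first
  part are deleted, which costs only \<open>O(n)\<close> edges, and the rest is found in what remains.\<close>

lemma dense_contains:
  fixes H :: "'a ugraph" and \<gamma> :: real
  assumes "simple_graph H" and "\<And>B. is_block B H \<Longrightarrow> has_partite_representation B" and "\<gamma> > 0"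
  shows "\<exists>N. \<forall>n\<ge>N. \<forall>G. subgraph G (hypercube n) \<longrightarrow> \<gamma> * real n * 2 ^ n \<le> real (card (edges G)) \<longrightarrow>
           (\<exists>f. embeds f H (edges G) \<and> f ` verts H \<subseteq> verts G)"
  using assms
proof (induction "card (verts H)" arbitrary: H \<gamma> rule: less_induct)
  case less
  note H = less.prems(1) and blocks = less.prems(2) and \<gamma> = less.prems(3)
  have finH: "finite (verts H)" and edgeH: "\<And>e. e \<in> edges H \<Longrightarrow> e \<subseteq> verts H \<and> card e = 2"
    using H unfolding simple_graph_def by auto
  have "connected_graph H \<or> verts H = {} \<or> (\<exists>u\<in>verts H. \<exists>w\<in>verts H. \<not> reachable H u w)"
    unfolding connected_graph_def by blast
  moreover have "verts H = {} \<Longrightarrow> card (verts H) \<le> 1" by simp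
  moreover have "card (verts H) \<le> 1 \<or> card (verts H) \<ge> 2" by linarith
  ultimately consider "card (verts H) \<le> 1" | "connected_graph H" "card (verts H) \<ge> 2"
    | u w where "u \<in> verts H" "w \<in> verts H" "\<not> reachable H u w"
    by metis
  then show ?case
  proof cases
    case 1
    have noE: "edges H = {}"
    proof (rule ccontr)
      assume "edges H \<noteq> {}"
      then obtain e where "e \<in> edges H" by blast
      then have "card e \<le> card (verts H)" "card e = 2" using edgeH card_mono[OF finH] by blast+
      then show False using 1 by linarith
    qed
    show ?thesis
    proof (intro exI[of _ 1] allI impI)
      fix n G assume n: "1 \<le> n" and G: "subgraph G (hypercube n)" "\<gamma> * real n * 2 ^ n \<le> real (card (edges G))"
      have "\<gamma> * real n * 2 ^ n > 0" using \<gamma> n by simp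
      then have "edges G \<noteq> {}" using G(2) by (metis card.empty not_less of_nat_0)
      then obtain e where e: "e \<in> edges G" by blast
      then have "e \<subseteq> verts G" "card e = 2" using G(1) unfolding subgraph_def simple_graph_def by auto
      then obtain x where x: "x \<in> verts G" by (metis card.empty ex_in_conv subset_empty zero_neq_numeral)
      have "inj_on (\<lambda>_. x) (verts H)"
        using 1 finH by (auto simp: inj_on_def card_le_Suc0_iff_eq)
      then show "\<exists>f. embeds f H (edges G) \<and> f ` verts H \<subseteq> verts G"
        using noE x by (intro exI[of _ "\<lambda>_. x"]) (auto simp: embeds_def)
    qed
  next
    case 2
    then obtain r where r: "r \<in> verts H" unfolding connected_graph_def by blast
    then have "unavoidable_at H r" using connected_unavoidable[OF H 2 blocks] by blast
    then obtain N where N: "\<forall>n\<ge>N. \<forall>E\<subseteq>edges (hypercube n). \<gamma> * real n * 2 ^ n \<le> real (card E) \<longrightarrow>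
        (\<exists>f. embeds f H E \<and> even (card (f r)) = True)"
      using \<gamma> unfolding unavoidable_at_def by blast
    show ?thesis
    proof (intro exI[of _ N] allI impI)
      fix n G assume n: "N \<le> n" and G: "subgraph G (hypercube n)" "\<gamma> * real n * 2 ^ n \<le> real (card (edges G))"
      then obtain f where f: "embeds f H (edges G)" using N unfolding subgraph_def by blast
      have "f x \<in> verts G" if "x \<in> verts H" for x
      proof -
        obtain w where "{x, w} \<in> edges H" using connected_no_isolated[OF 2] \<open>x \<in> verts H\<close> by blast
        then have "f ` {x, w} \<in> edges G" using f unfolding embeds_def by blast
        then have "{f x, f w} \<in> edges G" by simp
        moreover have "simple_graph G" using G(1) by (simp add: subgraph_def)
        ultimately show ?thesis using simple_graph_edge_verts(1) by metis
      qed
      then show "\<exists>f. embeds f H (edges G) \<and> f ` verts H \<subseteq> verts G" using f by blast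
    qed
  next
    case 3
    define C where "C = {x \<in> verts H. reachable H u x}"
    define H1 where "H1 = induced_subgraph H (insert u C)"
    define H2 where "H2 = induced_subgraph H (- C)"
    have closed: "y \<in> insert u C" if xy: "{x, y} \<in> edges H" "x \<in> C" for x y
    proof -
      have "reachable H u x" using xy(2) by (simp add: C_def)
      then have "reachable H u y" using xy(1) unfolding reachable_def by (simp add: rtrancl_into_rtrancl)
      moreover have "y \<in> verts H" using xy(1) simple_graph_edge_verts(2)[OF H] by blast
      ultimately show ?thesis by (simp add: C_def)
    qed
    have gl: "glued H H1 H2 u" unfolding H1_def H2_def by (rule glued_induced[OF H]) (rule closed)
    have uC: "u \<in> C" and wC: "w \<notin> C" using 3 by (auto simp: C_def reachable_def)
    have V1: "verts H1 = C" and V2: "verts H2 = verts H - C"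
      using uC by (auto simp: H1_def H2_def induced_subgraph_def C_def)
    have simple: "simple_graph H1" "simple_graph H2" and edges: "edges H = edges H1 \<union> edges H2"
      using gl unfolding glued_def by auto
    have "verts H1 \<subset> verts H" "verts H2 \<subset> verts H" using V1 V2 uC wC 3 by (auto simp: C_def)
    then have lt: "card (verts H1) < card (verts H)" "card (verts H2) < card (verts H)"
      using finH by (auto intro: psubset_card_mono)
    have bl1: "has_partite_representation B" if "is_block B H1" for B
      using that blocks glued_is_block[OF gl] by blast
    have bl2: "has_partite_representation B" if "is_block B H2" for B
      using that blocks glued_is_block[OF glued_sym[OF gl]] by blast
    have "\<gamma> / 2 > 0" using \<gamma> by simp
    obtain N1 where N1: "\<forall>n\<ge>N1. \<forall>G. subgraph G (hypercube n) \<longrightarrow> \<gamma> * real n * 2 ^ n \<le> real (card (edges G)) \<longrightarrow>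
           (\<exists>f. embeds f H1 (edges G) \<and> f ` verts H1 \<subseteq> verts G)"
      by (rule exE[OF less.hyps[OF lt(1) simple(1) bl1 \<gamma>]]) (assumption | rule that)+
    obtain N2 where N2: "\<forall>n\<ge>N2. \<forall>G. subgraph G (hypercube n) \<longrightarrow> \<gamma> / 2 * real n * 2 ^ n \<le> real (card (edges G)) \<longrightarrow>
           (\<exists>f. embeds f H2 (edges G) \<and> f ` verts H2 \<subseteq> verts G)"
      by (rule exE[OF less.hyps[OF lt(2) simple(2) bl2 \<open>\<gamma> / 2 > 0\<close>]]) (assumption | rule that)+
    define h where "h = card (verts H1)"
    define N where "N = max (max N1 N2) (nat \<lceil>2 * real h / \<gamma>\<rceil>)"
    show ?thesis
    proof (intro exI[of _ N] allI impI)
      fix n G assume n: "N \<le> n" and G: "subgraph G (hypercube n)" "\<gamma> * real n * 2 ^ n \<le> real (card (edges G))"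
      have "n \<ge> N1" "n \<ge> N2" using n by (auto simp: N_def)
      then obtain f1 where f1: "embeds f1 H1 (edges G)" "f1 ` verts H1 \<subseteq> verts G" using N1 G by blast
      define X where "X = f1 ` verts H1"
      have finX: "finite X" "card X \<le> h"
        using simple(1) unfolding X_def h_def simple_graph_def by (auto intro: card_image_le)
      define G' where "G' = induced_subgraph G (- X)"
      have EG: "edges G \<subseteq> edges (hypercube n)" using G(1) unfolding subgraph_def by blast
      then have finE: "finite (edges G)" using finite_edges_hypercube finite_subset by blast
      have G': "edges G' = edges G - {e\<in>edges G. e \<inter> X \<noteq> {}}" "verts G' = verts G - X"
        by (auto simp: G'_def induced_subgraph_def)
      have subG': "subgraph G' (hypercube n)"
        using G(1) unfolding subgraph_def simple_graph_def G'_def induced_subgraph_def by auto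
      have "card (edges G') = card (edges G) - card {e\<in>edges G. e \<inter> X \<noteq> {}}"
        unfolding G'(1) using finE by (intro card_Diff_subset) auto
      moreover have "card {e\<in>edges G. e \<inter> X \<noteq> {}} \<le> h * n"
        using card_edges_touching_le[OF EG finX(1)] finX(2) by (meson le_trans mult_le_mono1)
      ultimately have "card (edges G) \<le> card (edges G') + h * n" by linarith
      then have "real (card (edges G)) \<le> real (card (edges G') + h * n)" by (rule of_nat_mono)
      then have c: "real (card (edges G)) - real h * real n \<le> real (card (edges G'))" by simp
      have "2 * real h / \<gamma> \<le> real n" using n unfolding N_def by linarith
      also have "real n \<le> 2 ^ n" using of_nat_less_two_power[of n, where 'a = real] by simp
      finally have "real h \<le> \<gamma> / 2 * 2 ^ n" using \<gamma> by (simp add: field_simps)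
      then have "real h * real n \<le> \<gamma> / 2 * 2 ^ n * real n" by (rule mult_right_mono) simp
      then have "\<gamma> / 2 * real n * 2 ^ n \<le> real (card (edges G'))" using c G(2) by (simp add: algebra_simps)
      then obtain f2 where f2: "embeds f2 H2 (edges G')" "f2 ` verts H2 \<subseteq> verts G'"
        using N2 \<open>n \<ge> N2\<close> subG' by blast
      define f where "f = (\<lambda>x. if x \<in> verts H1 then f1 x else f2 x)"
      have fX: "f x \<in> X \<longleftrightarrow> x \<in> verts H1" if "x \<in> verts H" for x
        using that V1 V2 f2(2) G'(2) by (auto simp: f_def X_def)
      have "inj_on f (verts H)"
      proof (rule inj_onI)
        fix x y assume xy: "x \<in> verts H" "y \<in> verts H" "f x = f y"
        then have "x \<in> verts H1 \<longleftrightarrow> y \<in> verts H1" using fX by metis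
        then show "x = y"
          using xy f1(1) f2(1) V1 V2 by (auto simp: f_def embeds_def inj_on_def split: if_splits)
      qed
      moreover have "f ` e \<in> edges G" if e: "e \<in> edges H" for e
      proof (cases "e \<in> edges H1")
        case True
        then have "f ` e = f1 ` e" using simple(1) by (intro image_cong) (auto simp: f_def simple_graph_def)
        then show ?thesis using f1(1) True unfolding embeds_def by simp
      next
        case False
        then have e2: "e \<in> edges H2" using e edges by blast
        then have "f ` e = f2 ` e" using simple(2) V1 V2 by (intro image_cong) (auto simp: f_def simple_graph_def)
        then show ?thesis using f2(1) e2 G'(1) unfolding embeds_def by auto
      qed
      moreover have "f ` verts H \<subseteq> verts G"
        using f1(2) f2(2) G'(2) V1 V2 by (auto simp: f_def)
      ultimately show "\<exists>f. embeds f H (edges G) \<and> f ` verts H \<subseteq> verts G"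
        unfolding embeds_def by blast
    qed
  qed
qed

lemma contains_copy_if_embeds:
  assumes H: "simple_graph H" and f: "embeds f H (edges G)" "f ` verts H \<subseteq> verts G"
  shows "contains_copy G H"
proof -
  let ?H' = "Graph (f ` verts H) ((`) f ` edges H)"
  have inj: "inj_on f (verts H)" using f(1) unfolding embeds_def by blast
  have "card (f ` e) = 2" if "e \<in> edges H" for e
    using H that inj card_image[of f e] unfolding simple_graph_def by (metis inj_on_subset)
  then have "simple_graph ?H'" using H unfolding simple_graph_def by auto
  then have "subgraph ?H' G" using f unfolding subgraph_def embeds_def by auto
  moreover have "isomorphic H ?H'" unfolding isomorphic_def using inj by (auto simp: bij_betw_def)
  ultimately show ?thesis unfolding contains_copy_def by blast
qed

theorem theorem1:
  fixes H :: "'a ugraph"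
  assumes "simple_graph H"
    and "\<And>B. is_block B H \<Longrightarrow> has_partite_representation B"
  shows "zero_turan_density H"
  unfolding zero_turan_density_def
proof (rule landau_o.smallI)
  fix c :: real assume c: "c > 0"
  then have half_pos: "c / 2 > 0" by simp
  obtain N where N: "\<forall>n\<ge>N. \<forall>G. subgraph G (hypercube n) \<longrightarrow> c / 2 * real n * 2 ^ n \<le> real (card (edges G)) \<longrightarrow>
           (\<exists>f. embeds f H (edges G) \<and> f ` verts H \<subseteq> verts G)"
    by (rule exE[OF dense_contains[OF assms half_pos]]) (assumption | rule that)+
  have "real (turan_ex (hypercube n) H) \<le> c * real (card (edges (hypercube n)))" if n: "n \<ge> N" for n
  proof -
    let ?S = "{card (edges G) | G. subgraph G (hypercube n) \<and> \<not> contains_copy G H}"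
    have bound: "real s \<le> c * real (card (edges (hypercube n)))" if "s \<in> ?S" for s
    proof -
      obtain G where G: "s = card (edges G)" "subgraph G (hypercube n)" "\<not> contains_copy G H"
        using \<open>s \<in> ?S\<close> by blast
      then have "\<not> c / 2 * real n * 2 ^ n \<le> real (card (edges G))"
        using N n contains_copy_if_embeds[OF assms(1), of _ G] by blast
      then have "real s < c / 2 * (real n * 2 ^ n)" using G(1) by simp
      also have "\<dots> \<le> c / 2 * (2 * real (card (edges (hypercube n))))"
        using c card_edges_hypercube_ge[of n] by (intro mult_left_mono) auto
      finally show ?thesis by simp
    qed
    show ?thesis
    proof (cases "?S = {}")
      case True
      then have "turan_ex (hypercube n) H = 0" by (simp only: turan_ex_def Sup_nat_empty)
      then show ?thesis using c by simp
    next
      case False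
      have "?S \<subseteq> {..nat \<lfloor>c * real (card (edges (hypercube n)))\<rfloor>}"
        using le_nat_floor[OF bound] by (intro subsetI) (simp only: atMost_iff)
      then have "finite ?S" by (rule finite_subset) simp
      from Max_in[OF this False] have "Sup ?S \<in> ?S"
        unfolding cSup_eq_Max[OF \<open>finite ?S\<close> False] .
      then show ?thesis unfolding turan_ex_def by (rule bound)
    qed
  qed
  then show "\<forall>\<^sub>F n in at_top. norm (real (turan_ex (hypercube n) H))
      \<le> c * norm (real (card (edges (hypercube n))))"
    unfolding eventually_at_top_linorder by (intro exI[of _ N]) auto
qed

end
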